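(* Suppose Assumption 1 holds with $\alpha\in(0,1]$. Let $(f_t)_{t\in\mathbb N}$ be the online gradient descent iterates with step sizes $\eta_t=\eta_1t^{-\theta}$, where $\theta\in\big(\frac{1}{1+\alpha},1\big)$ and $0<\eta_1\le\frac{1}{A\kappa^2}$. Then for every $\epsilon>0$, $$\lim_{t\to\infty} t^{\min\{1-\theta,\,(1+\alpha)\theta-1\}-\epsilon}\big(\mathcal E(f_t)-\mathcal E(f_H)\big)=0\quad\text{almost surely.}$$ In particular, for $\theta=\frac{2}{2+\alpha}$, $\lim_{t\to\infty}t^{\frac{\alpha}{2+\alpha}-\epsilon}\big(\mathcal E(f_t)-\mathcal E(f_H)\big)=0$ almost surely.
   Context: Setting: Let $\mathcal X\subset\mathbb R^d$, $\mathcal Y\subset\mathbb R$, $\mathcal Z=\mathcal X\times\mathcal Y$, and let $\rho$ be a Borel probability measure on $\mathcal Z$. Let $K:\mathcal X\times\mathcal X\to\mathbb R$ be a continuous, symmetric, positive semi-definite kernel with reproducing kernel Hilbert space $H_K$ (inner product $\langle\cdot,\cdot\rangle$, norm $\|\cdot\|$), $K_x:=K(x,\cdot)$, reproducing property $f(x)=\langle f,K_x\rangle$, and $\kappa:=\sup_{x\in\mathcal X}\sqrt{K(x,x)}<\infty$. Let $\phi:\mathcal Y\times\mathbb R\to[0,\infty)$ be a loss function, differentiable in its second argument, and write $\phi'(y,s)$ for its derivative with respect to $s$. The generalization error of $f:\mathcal X\to\mathbb R$ is $\mathcal E(f)=\int_{\mathcal Z}\phi(y,f(x))\,d\rho(x,y)$.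 It is assumed that a minimizer $f_H\in\arg\min_{f\in H_K}\mathcal E(f)$ exists and that $\max\{\sup_{y\in\mathcal Y}\phi(y,0),\ \sup_{(x,y)\in\mathcal Z}\phi(y,f_H(x))\}<\infty$. Let $z_t=(x_t,y_t)$, $t\in\mathbb N$, be i.i.d. samples from $\rho$, let $(\eta_t)_{t\in\mathbb N}$ be positive step sizes, and define the online gradient descent iterates by $f_1=0$ and $f_{t+1}=f_t-\eta_t\phi'(y_t,f_t(x_t))K_{x_t}$ for $t\in\mathbb N$ (so $f_t$ depends only on $z_1,\dots,z_{t-1}$). Assumption 1: for every $y\in\mathcal Y$, $\phi(y,\cdot)$ is convex and differentiable, and there are constants $\alpha\in(0,1]$, $L>0$ with $|\phi'(y,s)-\phi'(y,\tilde s)|\le L|s-\tilde s|^{\alpha}$ for all $s,\tilde s\in\mathbb R$, $y\in\mathcal Y$. Constants: $A=2\alpha^{\frac{1-\alpha}{1+\alpha}}L^{\frac{2}{1+\alpha}}(1+\alpha)$ and $B=\alpha^{-\frac{2\alpha}{1+\alpha}}L^{\frac{2}{1+\alpha}}(1-\alpha^2)$. *)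

theory Defs
  imports "HOL-Probability.Probability"
begin

text \<open>Online gradient descent iterates, indexed from 1 as in the paper:
  ogd K dphi eta z 1 = 0 and, for t >= 1,
  ogd (t+1) = ogd t - eta t * dphi y_t (ogd t x_t) * K x_t, where z t = (x_t, y_t).
  The value at index 0 is a dummy (the zero function) and is never used.\<close>
fun ogd :: "('x \<Rightarrow> 'x \<Rightarrow> real) \<Rightarrow> (real \<Rightarrow> real \<Rightarrow> real) \<Rightarrow> (nat \<Rightarrow> real)
            \<Rightarrow> (nat \<Rightarrow> 'x \<times> real) \<Rightarrow> nat \<Rightarrow> 'x \<Rightarrow> real" where
  "ogd K dphi eta z 0 = (\<lambda>u. 0)"
| "ogd K dphi eta z (Suc t) =
     (if t = 0 then (\<lambda>u. 0)
      else (\<lambda>u. ogd K dphi eta z t u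
                 - eta t * dphi (snd (z t)) (ogd K dphi eta z t (fst (z t))) * K (fst (z t)) u))"

definition gen_err :: "('x \<times> real) measure \<Rightarrow> (real \<Rightarrow> real \<Rightarrow> real) \<Rightarrow> ('x \<Rightarrow> real) \<Rightarrow> real" where
  "gen_err \<rho> phi f = (\<integral>z. phi (snd z) (f (fst z)) \<partial>\<rho>)"

definition const_A :: "real \<Rightarrow> real \<Rightarrow> real" where
  "const_A \<alpha> L = 2 * \<alpha> powr ((1 - \<alpha>) / (1 + \<alpha>)) * L powr (2 / (1 + \<alpha>)) * (1 + \<alpha>)"

definition step :: "real \<Rightarrow> real \<Rightarrow> nat \<Rightarrow> real" where
  "step \<eta>1 \<theta> t = \<eta>1 * real t powr (- \<theta>)"

end

theory Submission
  imports Defs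
begin

text \<open>Write \<open>e t\<close> for the excess risk of the \<open>t\<close>-th iterate. Expanding the squared Hilbert space distance to
  the minimiser and using convexity and the self-bounding property \<open>dphi\<^sup>2 \<le> C (1 + \<phi>)\<close> gives that
  \<open>\<Sum>t. \<eta> t * E (e t)\<close> is finite. Hoelder smoothness of the risk gives the drift bound
  \<open>E (e (t + 1) | past) \<le> e t + C (\<eta> t) powr (1 + \<alpha>) (1 + e t)\<close>. Hence for
  \<open>\<gamma> < min (1 - \<theta>) ((1 + \<alpha>) \<theta> - 1)\<close> the process \<open>t powr \<gamma> * e t\<close> is a nonnegative supermartingale
  up to a summable drift, and a maximal inequality shows that it is almost surely bounded. No martingale
  convergence theorem is needed, since the arbitrary \<open>\<epsilon>\<close> turns boundedness into convergence to 0.\<close>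

section \<open>Supermartingales with summable drift\<close>

text \<open>Both constraints on \<gamma> are summability conditions. Replacing the weight
  \<open>t powr \<gamma>\<close> by \<open>(t + 1) powr \<gamma>\<close> costs at most
  \<open>t powr (\<gamma> - 1) * e t\<close>; its mean is dominated by the summable
  \<open>t powr (- \<theta>) * E (e t)\<close> when \<gamma> \<le> 1 - \<theta>. The Hoelder
  remainder costs a multiple of \<open>t powr (\<gamma> - (1 + \<alpha>) * \<theta>)\<close>,
  summable when \<gamma> < (1 + \<alpha>) \<theta> - 1. The obstacle that shapes the proof is
  measurability: the Hilbert space may be non-separable, so iterates and gradients are never
  integrated as vectors. Only real quantities are: values of iterates, risks, squared distances,
  double integrals of the kernel. Likewise, conditioning on the past is replaced by Fubini over the
  next sample, with weights in [0, 1] that depend on the past.\<close>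

lemma summable_of_drift:
  fixes r a b :: "nat \<Rightarrow> real"
  assumes "\<And>t. 0 \<le> r t" "\<And>t. 0 \<le> a t" "summable b" "\<And>t. 0 \<le> b t"
    and drift: "\<And>t. T \<le> t \<Longrightarrow> r (Suc t) + a t \<le> r t + b t"
  shows "summable a"
proof -
  have sb: "summable (\<lambda>i. b (i + T))" using assms(3) by (rule summable_ignore_initial_segment)
  have "(\<Sum>i<n. a (i + T)) + r (n + T) \<le> r T + (\<Sum>i<n. b (i + T))" for n
  proof (induction n)
    case (Suc n)
    then show ?case using drift[of "n + T"] by simp
  qed simp
  moreover have "(\<Sum>i<n. b (i + T)) \<le> suminf (\<lambda>i. b (i + T))" for n
    using assms(4) by (intro sum_le_suminf sb) auto
  ultimately have "(\<Sum>i<n. a (i + T)) \<le> r T + suminf (\<lambda>i. b (i + T))" for n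
    using assms(1)[of "n + T"] by (meson add_left_mono add_increasing2 le_add_same_cancel1 order_trans)
  then have "summable (\<lambda>i. a (i + T))"
    using assms(2) by (intro summableI_nonneg_bounded) auto
  then show ?thesis by (simp add: summable_iff_shift)
qed

text \<open>Doob's maximal inequality for the process stopped at its first passage above \<open>l\<close>; restricting to
  the events \<open>W 0, \<dots>, W t < l\<close> replaces conditional expectations.\<close>

lemma (in prob_space) AE_bounded_of_maximal_inequality:
  fixes W :: "nat \<Rightarrow> 'a \<Rightarrow> real"
  assumes int: "\<And>t. integrable M (W t)"
    and nonneg: "\<And>t \<omega>. \<omega> \<in> space M \<Longrightarrow> 0 \<le> W t \<omega>"
    and d: "summable d" "\<And>t. 0 \<le> d t"
    and drift: "\<And>t l. (\<integral>\<omega>. indicator {\<omega>. \<forall>s\<le>t. W s \<omega> < l} \<omega> * W (Suc t) \<omega> \<partial>M)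
        \<le> (\<integral>\<omega>. indicator {\<omega>. \<forall>s\<le>t. W s \<omega> < l} \<omega> * W t \<omega> \<partial>M) + d t"
  shows "AE \<omega> in M. \<exists>b. \<forall>t. W t \<omega> \<le> b"
proof -
  define C where "C = expectation (W 0) + suminf d"
  define B where "B l t = {\<omega>\<in>space M. \<exists>s\<le>t. l \<le> W s \<omega>}" for l t
  have [measurable]: "W t \<in> borel_measurable M" for t using int by auto
  have Bm[measurable]: "B l t \<in> events" for l t unfolding B_def by measurable
  have tail: "prob (B l t) \<le> C / l" if l: "0 < l" for l t
  proof -
    let ?A = "\<lambda>t. {\<omega>. \<forall>s\<le>t. W s \<omega> < l}"
    \<comment> \<open>\<open>?U\<close> is the stopped process capped at \<open>l\<close>: the
      current value before the passage, the constant \<open>l\<close> afterwards.\<close>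
    let ?U = "\<lambda>t \<omega>. indicator (?A t) \<omega> * W t \<omega> + l * indicator (B l t) \<omega>"
    have iA: "integrable M (\<lambda>\<omega>. indicator (?A t) \<omega> * W s \<omega>)" for t s
      by (rule Bochner_Integration.integrable_bound[OF int[of s]])
        (auto simp: indicator_def)
    have iB: "integrable M (\<lambda>\<omega>. l * indicator (B l t) \<omega>)" for t
      by (intro integrable_mult_right integrable_real_indicator) (auto simp: emeasure_eq_measure)
    have U: "(\<integral>\<omega>. ?U t \<omega> \<partial>M) \<le> expectation (W 0) + (\<Sum>s<t. d s)" for t
    proof (induction t)
      case 0
      have "(\<integral>\<omega>. ?U 0 \<omega> \<partial>M) \<le> (\<integral>\<omega>. W 0 \<omega> \<partial>M)"
        by (rule integral_mono[OF Bochner_Integration.integrable_add[OF iA iB] int])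
          (auto simp: indicator_def B_def)
      then show ?case by simp
    next
      case (Suc t)
      \<comment> \<open>Pointwise: a path that first reaches \<open>l\<close> at time
        \<open>Suc t\<close> has \<open>l \<le> W (Suc t) \<omega>\<close>, so capping can only
        decrease it; all other paths give equality.\<close>
      have "(\<integral>\<omega>. ?U (Suc t) \<omega> \<partial>M)
          \<le> (\<integral>\<omega>. indicator (?A t) \<omega> * W (Suc t) \<omega> + l * indicator (B l t) \<omega> \<partial>M)"
        by (rule integral_mono[OF Bochner_Integration.integrable_add[OF iA iB]
              Bochner_Integration.integrable_add[OF iA iB]])
          (auto simp: indicator_def B_def le_Suc_eq not_less not_le nonneg
            dest: le_less_trans less_le_trans)
      also have "\<dots> = (\<integral>\<omega>. indicator (?A t) \<omega> * W (Suc t) \<omega> \<partial>M) + (\<integral>\<omega>. l * indicator (B l t) \<omega> \<partial>M)"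
        by (rule Bochner_Integration.integral_add[OF iA iB])
      also have "\<dots> \<le> (\<integral>\<omega>. indicator (?A t) \<omega> * W t \<omega> \<partial>M) + d t + (\<integral>\<omega>. l * indicator (B l t) \<omega> \<partial>M)"
        using drift[of t l] by simp
      also have "\<dots> = (\<integral>\<omega>. ?U t \<omega> \<partial>M) + d t"
        by (subst Bochner_Integration.integral_add[OF iA iB]) simp
      finally show ?case using Suc by simp
    qed
    have "l * prob (B l t) = (\<integral>\<omega>. l * indicator (B l t) \<omega> \<partial>M)"
      by simp
    also have "\<dots> \<le> (\<integral>\<omega>. ?U t \<omega> \<partial>M)"
      by (rule integral_mono[OF iB Bochner_Integration.integrable_add[OF iA iB]])
        (auto simp: nonneg)
    also have "\<dots> \<le> expectation (W 0) + (\<Sum>s<t. d s)" by (rule U)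
    also have "\<dots> \<le> C" unfolding C_def using sum_le_suminf[OF d(1), of "{..<t}"] d(2) by auto
    finally show ?thesis using l by (simp add: field_simps)
  qed
  have sup: "prob (\<Union>t. B l t) \<le> C / l" if "0 < l" for l
  proof (rule LIMSEQ_le_const2)
    show "(\<lambda>t. prob (B l t)) \<longlonglongrightarrow> prob (\<Union>t. B l t)"
      by (rule finite_Lim_measure_incseq) (auto simp: incseq_def B_def intro: order_trans)
    show "\<exists>N. \<forall>n\<ge>N. prob (B l n) \<le> C / l" using tail[OF that] by blast
  qed
  \<comment> \<open>The event that the process reaches every positive integer level, that is, is
    unbounded.\<close>
  let ?N = "\<Inter>n. \<Union>t. B (real (Suc n)) t"
  have "prob ?N \<le> C * inverse (real (Suc n))" for n
  proof -
    have "prob ?N \<le> prob (\<Union>t. B (real (Suc n)) t)" by (rule finite_measure_mono) auto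
    also have "\<dots> \<le> C * inverse (real (Suc n))" using sup[of "real (Suc n)"] by (simp add: divide_inverse)
    finally show ?thesis .
  qed
  moreover have "(\<lambda>n. C * inverse (real (Suc n))) \<longlonglongrightarrow> C * 0"
    by (intro tendsto_mult tendsto_const LIMSEQ_inverse_real_of_nat)
  ultimately have "prob ?N \<le> C * 0" by (intro LIMSEQ_le_const) auto
  then have "prob ?N \<le> 0" by simp
  then have "emeasure M ?N = 0" by (simp add: emeasure_eq_measure measure_le_0_iff)
  then have "AE \<omega> in M. \<omega> \<notin> ?N" by (intro AE_not_in null_setsI) auto
  then show ?thesis
  proof (rule AE_mp, intro AE_I2 impI)
    fix \<omega> assume "\<omega> \<in> space M" "\<omega> \<notin> ?N"
    then obtain n where "\<forall>t. \<omega> \<notin> B (real (Suc n)) t" by blast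
    then have "\<forall>t. W t \<omega> \<le> real (Suc n)"
      using \<open>\<omega> \<in> space M\<close> unfolding B_def by (auto simp: not_le intro: less_imp_le)
    then show "\<exists>b. \<forall>t. W t \<omega> \<le> b" by blast
  qed
qed

text \<open>Fubini for the joint law, which independence makes a product; boundedness supplies the
  integrability. This plays the part of conditioning on \<open>U\<close>.\<close>

lemma (in prob_space) expectation_indep_var:
  fixes F :: "'b \<Rightarrow> 'b \<Rightarrow> real"
  assumes ind: "indep_var S U T V"
    and F[measurable]: "case_prod F \<in> borel_measurable (S \<Otimes>\<^sub>M T)"
    and bound: "\<And>u v. u \<in> space S \<Longrightarrow> v \<in> space T \<Longrightarrow> \<bar>F u v\<bar> \<le> b"
  shows "expectation (\<lambda>\<omega>. F (U \<omega>) (V \<omega>)) = expectation (\<lambda>\<omega>. \<integral>v. F (U \<omega>) v \<partial>distr M T V)"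
proof -
  have U[measurable]: "U \<in> measurable M S" and V[measurable]: "V \<in> measurable M T"
    using ind by (auto dest: indep_var_rv1 indep_var_rv2)
  interpret S: prob_space "distr M S U" by (rule prob_space_distr) fact
  interpret T: prob_space "distr M T V" by (rule prob_space_distr) fact
  interpret P: pair_prob_space "distr M S U" "distr M T V" ..
  have "expectation (\<lambda>\<omega>. F (U \<omega>) (V \<omega>))
      = (\<integral>p. case_prod F p \<partial>distr M (S \<Otimes>\<^sub>M T) (\<lambda>\<omega>. (U \<omega>, V \<omega>)))"
    by (subst integral_distr) auto
  also have "\<dots> = (\<integral>p. case_prod F p \<partial>(distr M S U \<Otimes>\<^sub>M distr M T V))"
    using ind unfolding indep_var_distribution_eq by simp
  also have "\<dots> = (\<integral>u. \<integral>v. F u v \<partial>distr M T V \<partial>distr M S U)"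
    by (subst P.integral_fst'[symmetric], rule P.integrable_const_bound[of _ b])
      (use bound in \<open>auto simp: space_pair_measure\<close>)
  also have "\<dots> = expectation (\<lambda>\<omega>. \<integral>v. F (U \<omega>) v \<partial>distr M T V)"
    by (rule integral_distr) (auto intro!: T.borel_measurable_lebesgue_integral)
  finally show ?thesis .
qed

section \<open>Hoelder smooth convex losses\<close>

locale holder_smooth_loss =
  fixes Y :: "real set" and \<phi> dphi :: "real \<Rightarrow> real \<Rightarrow> real" and \<alpha> L :: real
  assumes loss_nonneg: "y \<in> Y \<Longrightarrow> 0 \<le> \<phi> y s"
    and loss_deriv: "y \<in> Y \<Longrightarrow> (\<phi> y has_real_derivative dphi y s) (at s)"
    and loss_convex: "y \<in> Y \<Longrightarrow> convex_on UNIV (\<phi> y)"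
    and alpha: "0 < \<alpha>" "\<alpha> \<le> 1"
    and L_pos: "0 < L"
    and loss_holder: "y \<in> Y \<Longrightarrow> \<bar>dphi y s - dphi y s'\<bar> \<le> L * \<bar>s - s'\<bar> powr \<alpha>"
begin

text \<open>The mean value theorem gives a point within \<bar>u\<bar> of \<open>s\<close>, and
  Hoelder continuity compares the derivative there with the one at \<open>s\<close>. The price is
  the constant \<open>L\<close> in place of the \<open>L / (1 + \<alpha>)\<close> that integrating
  the derivative would give.\<close>

lemma loss_smooth:
  assumes "y \<in> Y"
  shows "\<phi> y (s + u) \<le> \<phi> y s + dphi y s * u + L * \<bar>u\<bar> powr (1 + \<alpha>)"
proof (cases "u = 0")
  case False
  have "\<exists>r. \<bar>r - s\<bar> \<le> \<bar>u\<bar> \<and> \<phi> y (s + u) - \<phi> y s = u * dphi y r"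
  proof (cases "0 < u")
    case True
    then obtain r where "s < r" "r < s + u" "\<phi> y (s + u) - \<phi> y s = (s + u - s) * dphi y r"
      using MVT2[of s "s + u" "\<phi> y" "dphi y"] loss_deriv[OF assms] by auto
    then show ?thesis by (intro exI[of _ r]) auto
  next
    case False
    with \<open>u \<noteq> 0\<close> obtain r where "s + u < r" "r < s" "\<phi> y s - \<phi> y (s + u) = (s - (s + u)) * dphi y r"
      using MVT2[of "s + u" s "\<phi> y" "dphi y"] loss_deriv[OF assms] by auto
    then show ?thesis by (intro exI[of _ r]) (auto simp: algebra_simps)
  qed
  then obtain r where r: "\<bar>r - s\<bar> \<le> \<bar>u\<bar>" "\<phi> y (s + u) - \<phi> y s = u * dphi y r" by blast
  have "u * (dphi y r - dphi y s) \<le> \<bar>u\<bar> * \<bar>dphi y r - dphi y s\<bar>"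
    by (metis abs_ge_self abs_mult)
  also have "\<dots> \<le> \<bar>u\<bar> * (L * \<bar>u\<bar> powr \<alpha>)"
    using loss_holder[OF assms, of r s] L_pos alpha r(1)
    by (intro mult_left_mono order_trans[OF loss_holder[OF assms]] powr_mono2) auto
  also have "\<dots> = L * \<bar>u\<bar> powr (1 + \<alpha>)"
    using False by (simp add: powr_add)
  finally show ?thesis using r(2) by (simp add: algebra_simps)
qed simp

lemma loss_tangent:
  assumes "y \<in> Y"
  shows "\<phi> y s - \<phi> y r \<le> dphi y s * (s - r)"
  using convex_on_imp_above_tangent[OF loss_convex[OF assms], of s r "dphi y s"]
    loss_deriv[OF assms, of s] by (auto simp: algebra_simps)

text \<open>Trades the fractional power for a square at the cost of an additive 1, which is the
  origin of \<open>1 + \<phi> y s\<close> in the self-bounding estimates.\<close>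

lemma powr_le_1_plus_square:
  assumes "0 \<le> (x::real)"
  shows "x powr (1 + \<alpha>) \<le> 1 + x\<^sup>2"
proof (cases "x \<le> 1")
  case True
  then have "x powr (1 + \<alpha>) \<le> 1" using assms alpha by (intro powr_le1) auto
  then show ?thesis by (simp add: add_increasing2)
next
  case False
  then have "x powr (1 + \<alpha>) \<le> x powr 2" using alpha by (intro powr_mono) auto
  then show ?thesis using False by simp
qed

text \<open>The value is \<open>1 + 2 / c\<close> for the step length \<open>c\<close> chosen in
  \<open>self_bounding\<close>.\<close>

definition self_const :: real where
  "self_const = 1 + 2 * (2 * L) powr (1 / \<alpha>)"

lemma self_const_pos: "0 < self_const"
  unfolding self_const_def by (simp add: add_pos_nonneg)

text \<open>A nonnegative smooth function cannot be steep where it is small: moving by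
  \<open>- c * g\<close> must not push the loss below 0.\<close>

lemma self_bounding:
  assumes "y \<in> Y"
  shows "(dphi y s)\<^sup>2 \<le> self_const * (1 + \<phi> y s)"
proof -
  define g where "g = dphi y s"
  \<comment> \<open>\<open>c\<close> solves \<open>L * c powr (1 + \<alpha>) = c / 2\<close>, so the
    Hoelder remainder uses up at most half of the gain \<open>c * g\<^sup>2\<close>, apart from an
    additive \<open>c / 2\<close>.\<close>
  define c where "c = (2 * L) powr (- 1 / \<alpha>)"
  have c: "0 < c" using L_pos by (simp add: c_def)
  have "c powr \<alpha> = 1 / (2 * L)"
    using L_pos alpha powr_minus_divide[of "2 * L" 1] by (simp add: c_def powr_powr)
  then have Lc: "L * c powr (1 + \<alpha>) = c / 2"
    using L_pos c by (simp add: powr_add)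
  have "0 \<le> \<phi> y (s + (- c * g))" using loss_nonneg[OF assms] .
  also have "\<dots> \<le> \<phi> y s + g * (- c * g) + L * \<bar>- c * g\<bar> powr (1 + \<alpha>)"
    using loss_smooth[OF assms, of s "- c * g"] by (simp add: g_def)
  also have "L * \<bar>- c * g\<bar> powr (1 + \<alpha>) = c / 2 * \<bar>g\<bar> powr (1 + \<alpha>)"
    using c by (simp add: abs_mult powr_mult Lc[symmetric])
  also have "\<dots> \<le> c / 2 * (1 + g\<^sup>2)"
    using powr_le_1_plus_square[of "\<bar>g\<bar>"] c by (intro mult_left_mono) auto
  finally have "c / 2 * g\<^sup>2 \<le> \<phi> y s + c / 2"
    by (simp add: power2_eq_square field_simps)
  then have "g\<^sup>2 \<le> 1 + 2 / c * \<phi> y s"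
    using c by (simp add: field_simps)
  also have "2 / c = 2 * (2 * L) powr (1 / \<alpha>)"
    using L_pos by (simp add: c_def powr_minus_divide)
  also have "1 + 2 * (2 * L) powr (1 / \<alpha>) * \<phi> y s \<le> self_const * (1 + \<phi> y s)"
    using loss_nonneg[OF assms, of s] by (simp add: self_const_def algebra_simps)
  finally show ?thesis unfolding g_def .
qed

lemma self_bounding_powr:
  assumes "y \<in> Y"
  shows "\<bar>dphi y s\<bar> powr (1 + \<alpha>) \<le> (1 + self_const) * (1 + \<phi> y s)"
  using powr_le_1_plus_square[of "\<bar>dphi y s\<bar>"] self_bounding[OF assms, of s] loss_nonneg[OF assms, of s]
  by (simp add: algebra_simps)

text \<open>Boundedness of the loss at 0 bounds the derivative at 0 by self-bounding;
  \<open>loss_smooth\<close> and Hoelder continuity carry both bounds to \<bar>s\<bar> \<le> b,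
  uniformly in \<open>y\<close>. All integrability of losses and gradients rests on this.\<close>

lemma bounded_on_bounded:
  assumes "bdd_above ((\<lambda>y. \<phi> y 0) ` Y)"
  obtains D where "\<And>y s. y \<in> Y \<Longrightarrow> \<bar>s\<bar> \<le> b \<Longrightarrow> \<phi> y s \<le> D"
    "\<And>y s. y \<in> Y \<Longrightarrow> \<bar>s\<bar> \<le> b \<Longrightarrow> \<bar>dphi y s\<bar> \<le> D"
proof -
  obtain m where m: "\<And>y. y \<in> Y \<Longrightarrow> \<phi> y 0 \<le> m"
    using assms unfolding bdd_above_def by auto
  have d0: "\<bar>dphi y 0\<bar> \<le> 1 + self_const * (1 + m)" if y: "y \<in> Y" for y
  proof -
    have "\<bar>dphi y 0\<bar> \<le> 1 + (dphi y 0)\<^sup>2"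
      using zero_le_power2[of "\<bar>dphi y 0\<bar> - 1"] zero_le_power2[of "dphi y 0"]
      by (simp add: power2_diff)
    also have "\<dots> \<le> 1 + self_const * (1 + \<phi> y 0)"
      using self_bounding[OF y, of 0] by simp
    also have "\<dots> \<le> 1 + self_const * (1 + m)"
      using m[OF y] self_const_pos by (intro add_left_mono mult_left_mono) auto
    finally show ?thesis .
  qed
  define g where "g = \<bar>1 + self_const * (1 + m)\<bar>"
  have phi: "\<phi> y s \<le> m + g * \<bar>b\<bar> + L * \<bar>b\<bar> powr (1 + \<alpha>)" if y: "y \<in> Y" and s: "\<bar>s\<bar> \<le> b" for y s
  proof -
    have "dphi y 0 * s \<le> g * \<bar>b\<bar>"
    proof -
      have "dphi y 0 * s \<le> \<bar>dphi y 0\<bar> * \<bar>s\<bar>" by (metis abs_ge_self abs_mult)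
      also have "\<dots> \<le> g * \<bar>b\<bar>" using d0[OF y] s unfolding g_def by (intro mult_mono) auto
      finally show ?thesis .
    qed
    moreover have "L * \<bar>s\<bar> powr (1 + \<alpha>) \<le> L * \<bar>b\<bar> powr (1 + \<alpha>)"
      using s L_pos alpha by (intro mult_left_mono powr_mono2) auto
    ultimately show ?thesis using loss_smooth[OF y, of 0 s] m[OF y] by simp
  qed
  have dphi: "\<bar>dphi y s\<bar> \<le> g + L * \<bar>b\<bar> powr \<alpha>" if y: "y \<in> Y" and s: "\<bar>s\<bar> \<le> b" for y s
  proof -
    have "L * \<bar>s\<bar> powr \<alpha> \<le> L * \<bar>b\<bar> powr \<alpha>"
      using s L_pos alpha by (intro mult_left_mono powr_mono2) auto
    then show ?thesis using loss_holder[OF y, of s 0] d0[OF y] unfolding g_def by simp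
  qed
  show thesis
    by (rule that[of "max (m + g * \<bar>b\<bar> + L * \<bar>b\<bar> powr (1 + \<alpha>)) (g + L * \<bar>b\<bar> powr \<alpha>)"])
      (use phi dphi in \<open>auto simp: le_max_iff_disj\<close>)
qed

end

section \<open>The iterates\<close>

text \<open>The reproducing kernel Hilbert space enters through a feature map: its members are the
  functions \<open>\<lambda>x. inner h (\<Phi> x)\<close> on \<open>X\<close>. As \<rho> lives on a
  restricted space, samples lie in \<open>X \<times> Y\<close> everywhere, not just almost surely.
  The step sizes stay general until the rates are derived.\<close>

locale kernel_sgd = holder_smooth_loss Y \<phi> dphi \<alpha> L + prob_space M + rho: prob_space \<rho>
  for Y \<phi> dphi \<alpha> L and M :: "'m measure" and \<rho> :: "('x::euclidean_space \<times> real) measure" +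
  fixes X :: "'x set" and K :: "'x \<Rightarrow> 'x \<Rightarrow> real" and \<Phi> :: "'x \<Rightarrow> 'h::real_inner" and \<kappa> :: real
    and fH :: "'x \<Rightarrow> real" and hH :: 'h
    and Zs :: "nat \<Rightarrow> 'm \<Rightarrow> 'x \<times> real" and \<eta> :: "nat \<Rightarrow> real"
  assumes K_cont: "continuous_on (X \<times> X) (\<lambda>p. K (fst p) (snd p))"
    and K_feat: "x \<in> X \<Longrightarrow> x' \<in> X \<Longrightarrow> K x x' = inner (\<Phi> x) (\<Phi> x')"
    and norm_feat: "x \<in> X \<Longrightarrow> norm (\<Phi> x) \<le> \<kappa>"
    and sets_rho: "sets \<rho> = sets (restrict_space borel (X \<times> Y))"
    and phi_meas: "(\<lambda>p. \<phi> (fst p) (snd p)) \<in> borel_measurable borel"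
    and fH_feat: "x \<in> X \<Longrightarrow> fH x = inner hH (\<Phi> x)"
    and fH_min: "gen_err \<rho> \<phi> fH \<le> gen_err \<rho> \<phi> (\<lambda>x. inner h (\<Phi> x))"
    and bdd0: "bdd_above ((\<lambda>y. \<phi> y 0) ` Y)"
    and Z_meas: "Zs t \<in> measurable M \<rho>"
    and Z_distr: "distr M \<rho> (Zs t) = \<rho>"
    and Z_indep: "indep_vars (\<lambda>_. \<rho>) Zs UNIV"
    and eta_nonneg: "0 \<le> \<eta> t"
begin

abbreviation iter :: "(nat \<Rightarrow> 'x \<times> real) \<Rightarrow> nat \<Rightarrow> 'x \<Rightarrow> real" where
  "iter w t \<equiv> ogd K dphi \<eta> w t"

abbreviation risk :: "('x \<Rightarrow> real) \<Rightarrow> real" where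
  "risk f \<equiv> gen_err \<rho> \<phi> f"

abbreviation sample :: "'m \<Rightarrow> nat \<Rightarrow> 'x \<times> real" where
  "sample \<omega> \<equiv> \<lambda>i. Zs i \<omega>"

declare Z_meas[measurable]

lemma space_rho: "space \<rho> = X \<times> Y"
  using sets_eq_imp_space_eq[OF sets_rho] by (simp add: space_restrict_space)

lemma sample_in: "\<omega> \<in> space M \<Longrightarrow> Zs i \<omega> \<in> X \<times> Y"
  using measurable_space[OF Z_meas, of \<omega> i] by (simp add: space_rho)

lemma kappa_nonneg: "x \<in> X \<Longrightarrow> 0 \<le> \<kappa>"
  using norm_feat[of x] norm_ge_zero order_trans by blast

lemma abs_K_le: "x \<in> X \<Longrightarrow> x' \<in> X \<Longrightarrow> \<bar>K x x'\<bar> \<le> \<kappa>\<^sup>2"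
  using Cauchy_Schwarz_ineq2[of "\<Phi> x" "\<Phi> x'"] mult_mono[OF norm_feat norm_feat, of x x'] kappa_nonneg
  by (simp add: K_feat power2_eq_square)

section \<open>Measurability of the kernel, the loss and the iterates\<close>

lemma borel_of_rho:
  assumes "u \<in> measurable N \<rho>"
  shows "u \<in> borel_measurable N" "(\<lambda>n. fst (u n)) \<in> borel_measurable N" "(\<lambda>n. snd (u n)) \<in> borel_measurable N"
    "\<And>n. n \<in> space N \<Longrightarrow> fst (u n) \<in> X" "\<And>n. n \<in> space N \<Longrightarrow> snd (u n) \<in> Y"
proof -
  show u: "u \<in> borel_measurable N"
    using assms unfolding measurable_cong_sets[OF refl sets_rho]
    by (auto simp: measurable_restrict_space2_iff)
  show "(\<lambda>n. fst (u n)) \<in> borel_measurable N"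
    by (rule measurable_compose[OF u]) (intro borel_measurable_continuous_onI continuous_intros)
  show "(\<lambda>n. snd (u n)) \<in> borel_measurable N"
    by (rule measurable_compose[OF u]) (intro borel_measurable_continuous_onI continuous_intros)
  show "\<And>n. n \<in> space N \<Longrightarrow> fst (u n) \<in> X" "\<And>n. n \<in> space N \<Longrightarrow> snd (u n) \<in> Y"
    using measurable_space[OF assms] by (auto simp: space_rho mem_Times_iff)
qed

lemma measurable_K:
  assumes "u \<in> measurable N \<rho>" "v \<in> measurable N \<rho>"
  shows "(\<lambda>n. K (fst (u n)) (fst (v n))) \<in> borel_measurable N"
proof -
  have "(\<lambda>n. (fst (u n), fst (v n))) \<in> measurable N (restrict_space borel (X \<times> X))"
    using borel_of_rho[OF assms(1)] borel_of_rho[OF assms(2)]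
    by (intro measurable_restrict_space2 borel_measurable_Pair) auto
  from measurable_compose[OF this borel_measurable_continuous_on_restrict[OF K_cont]]
  show ?thesis by simp
qed

lemma measurable_phi:
  assumes "y \<in> borel_measurable N" "s \<in> borel_measurable N"
  shows "(\<lambda>n. \<phi> (y n) (s n)) \<in> borel_measurable N"
  using measurable_compose[OF borel_measurable_Pair[OF assms] phi_meas] by simp

text \<open>Joint measurability is given for \<phi>; the derivative inherits it as the pointwise
  limit of difference quotients with increments \<open>1 / (k + 1)\<close>.\<close>

lemma measurable_dphi:
  assumes y: "y \<in> borel_measurable N" and s: "s \<in> borel_measurable N"
    and Y: "\<And>n. n \<in> space N \<Longrightarrow> y n \<in> Y"
  shows "(\<lambda>n. dphi (y n) (s n)) \<in> borel_measurable N"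
proof (rule borel_measurable_LIMSEQ_real)
  define e where "e k = inverse (real (Suc k))" for k
  show "(\<lambda>n. (\<phi> (y n) (s n + e k) - \<phi> (y n) (s n)) / e k) \<in> borel_measurable N" for k
    using y s by (intro borel_measurable_divide borel_measurable_diff measurable_phi borel_measurable_add) auto
  show "(\<lambda>k. (\<phi> (y n) (s n + e k) - \<phi> (y n) (s n)) / e k) \<longlonglongrightarrow> dphi (y n) (s n)" if "n \<in> space N" for n
  proof -
    have "filterlim e (at 0) sequentially"
      unfolding filterlim_at e_def using LIMSEQ_inverse_real_of_nat by auto
    from filterlim_compose[OF loss_deriv[OF Y[OF that], of "s n", unfolded DERIV_def] this]
    show ?thesis .
  qed
qed

lemma iter_cong: "(\<And>i. i < t \<Longrightarrow> w i = w' i) \<Longrightarrow> iter w t = iter w' t"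
proof (induction t)
  case (Suc t)
  then have "iter w t = iter w' t" "w t = w' t" by auto
  then show ?case by simp
qed simp

lemma iter_measurable:
  assumes "\<And>i. i < t \<Longrightarrow> (\<lambda>n. w n i) \<in> measurable N \<rho>" "z \<in> measurable N \<rho>"
  shows "(\<lambda>n. iter (w n) t (fst (z n))) \<in> borel_measurable N"
  using assms
\<comment> \<open>\<open>z\<close> is generalised because the recursion also evaluates the previous
  iterate at the new sample \<open>w n t\<close>.\<close>
proof (induction t arbitrary: z)
  case (Suc t)
  have w: "(\<lambda>n. w n t) \<in> measurable N \<rho>" using Suc.prems by auto
  have s: "(\<lambda>n. iter (w n) t (fst (v n))) \<in> borel_measurable N" if "v \<in> measurable N \<rho>" for v
    using Suc that by auto
  have "(\<lambda>n. dphi (snd (w n t)) (iter (w n) t (fst (w n t)))) \<in> borel_measurable N"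
    by (rule measurable_dphi[OF borel_of_rho(3)[OF w] s[OF w] borel_of_rho(5)[OF w]])
  then show ?case
    using s[OF Suc.prems(2)] measurable_K[OF w Suc.prems(2)] by (cases "t = 0") auto
qed simp

lemma risk_measurable:
  assumes "(\<lambda>p. f (fst p) (fst (snd p))) \<in> borel_measurable (N \<Otimes>\<^sub>M \<rho>)"
  shows "(\<lambda>n. risk (f n)) \<in> borel_measurable N"
  unfolding gen_err_def
  by (rule rho.borel_measurable_lebesgue_integral)
    (use assms in \<open>auto simp: case_prod_unfold intro!: measurable_phi borel_of_rho\<close>)

lemma risk_iter_measurable:
  assumes "\<And>i. i < t \<Longrightarrow> (\<lambda>n. w n i) \<in> measurable N \<rho>"
  shows "(\<lambda>n. risk (iter (w n) t)) \<in> borel_measurable N"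
  by (rule risk_measurable, rule iter_measurable)
    (use assms in \<open>auto intro: measurable_compose[OF measurable_fst]\<close>)

text \<open>The Hilbert space vector behind the iterate. Its coefficients come from the real-valued
  recursion instead of inner products with \<open>hvec\<close> itself; \<open>iter_eq_inner\<close>
  shows that the two agree on \<open>X\<close>.\<close>

fun hvec :: "(nat \<Rightarrow> 'x \<times> real) \<Rightarrow> nat \<Rightarrow> 'h" where
  "hvec w 0 = 0"
| "hvec w (Suc t) = (if t = 0 then 0 else
     hvec w t - (\<eta> t * dphi (snd (w t)) (iter w t (fst (w t)))) *\<^sub>R \<Phi> (fst (w t)))"

lemma iter_eq_inner:
  "(\<forall>i<t. w i \<in> X \<times> Y) \<Longrightarrow> x \<in> X \<Longrightarrow> iter w t x = inner (hvec w t) (\<Phi> x)"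
  by (induction t) (auto simp: inner_diff_left K_feat mem_Times_iff)

text \<open>A deterministic bound for each fixed \<open>t\<close>, valid on every sample path. It
  may grow with \<open>t\<close> and serves integrability only, not the rate.\<close>

lemma iter_bounded:
  obtains b where "\<And>w. (\<forall>i<t. w i \<in> X \<times> Y) \<Longrightarrow> norm (hvec w t) \<le> b"
    "\<And>w x. (\<forall>i<t. w i \<in> X \<times> Y) \<Longrightarrow> x \<in> X \<Longrightarrow> \<bar>iter w t x\<bar> \<le> b * \<kappa>"
proof -
  have iter: "\<bar>iter w t x\<bar> \<le> b * \<kappa>"
    if "\<forall>i<t. w i \<in> X \<times> Y" "x \<in> X" "norm (hvec w t) \<le> b" for w x t b
  proof -
    have "\<bar>iter w t x\<bar> \<le> norm (hvec w t) * norm (\<Phi> x)"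
      using Cauchy_Schwarz_ineq2 iter_eq_inner[OF that(1,2)] by simp
    also have "\<dots> \<le> b * \<kappa>"
      using that norm_feat by (intro mult_mono) (auto intro: order_trans[OF norm_ge_zero])
    finally show ?thesis .
  qed
  have "\<exists>b. \<forall>w. (\<forall>i<t. w i \<in> X \<times> Y) \<longrightarrow> norm (hvec w t) \<le> b"
  proof (induction t)
    case (Suc t)
    then obtain b where b: "\<And>w. (\<forall>i<t. w i \<in> X \<times> Y) \<Longrightarrow> norm (hvec w t) \<le> b" by blast
    obtain D where D: "\<And>y s. y \<in> Y \<Longrightarrow> \<bar>s\<bar> \<le> b * \<kappa> \<Longrightarrow> \<bar>dphi y s\<bar> \<le> D"
      using bounded_on_bounded[OF bdd0] by metis
    show ?case
    proof (intro exI allI impI)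
      fix w :: "nat \<Rightarrow> 'x \<times> real"
      assume w: "\<forall>i<Suc t. w i \<in> X \<times> Y"
      have wt: "fst (w t) \<in> X" "snd (w t) \<in> Y" using w by (auto simp: mem_Times_iff)
      have g: "\<bar>dphi (snd (w t)) (iter w t (fst (w t)))\<bar> \<le> D"
        using D[OF wt(2) iter[OF _ wt(1) b]] w by auto
      let ?v = "(\<eta> t * dphi (snd (w t)) (iter w t (fst (w t)))) *\<^sub>R \<Phi> (fst (w t))"
      have 1: "norm (hvec w t) \<le> b" using b w by auto
      have 2: "norm ?v \<le> \<eta> t * D * \<kappa>"
        unfolding norm_scaleR abs_mult using g norm_feat[OF wt(1)] eta_nonneg[of t]
        by (intro mult_mono) (auto intro!: mult_nonneg_nonneg order_trans[OF abs_ge_zero g])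
      show "norm (hvec w (Suc t)) \<le> b + \<eta> t * D * \<kappa>"
      proof (cases "t = 0")
        case False
        then show ?thesis using norm_triangle_ineq4[of "hvec w t" ?v] 1 2 by simp
      next
        case True
        then show ?thesis using 1 order_trans[OF norm_ge_zero 2] by simp
      qed
    qed
  qed (auto intro: exI[of _ 0])
  then show thesis using that iter by blast
qed

section \<open>Integration over a fresh sample\<close>

lemma integrable_bounded:
  fixes f :: "'x \<times> real \<Rightarrow> real"
  assumes "f \<in> borel_measurable \<rho>" "\<And>x y. x \<in> X \<Longrightarrow> y \<in> Y \<Longrightarrow> \<bar>f (x, y)\<bar> \<le> b"
  shows "integrable \<rho> f"
  by (rule rho.integrable_const_bound[of _ b]) (use assms in \<open>auto simp: space_rho\<close>)

text \<open>Stands in for the conditional expectation given the samples below index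
  \<open>t\<close>: the sample at \<open>t\<close> is integrated out. Restriction to
  \<open>{..<t}\<close> makes the past a point of the product space on which independence is
  stated.\<close>

lemma fresh_sample:
  fixes F :: "(nat \<Rightarrow> 'x \<times> real) \<Rightarrow> 'x \<times> real \<Rightarrow> real"
  assumes F[measurable]: "case_prod F \<in> borel_measurable (PiM {..<t} (\<lambda>_. \<rho>) \<Otimes>\<^sub>M \<rho>)"
    and past: "\<And>w z. F (restrict w {..<t}) z = F w z"
    and bound: "\<And>w z. (\<forall>i<t. w i \<in> X \<times> Y) \<Longrightarrow> z \<in> X \<times> Y \<Longrightarrow> \<bar>F w z\<bar> \<le> b"
  shows "expectation (\<lambda>\<omega>. F (sample \<omega>) (Zs t \<omega>)) = expectation (\<lambda>\<omega>. \<integral>z. F (sample \<omega>) z \<partial>\<rho>)"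
proof -
  let ?P = "PiM {..<t} (\<lambda>_. \<rho>)" and ?T = "PiM {t} (\<lambda>_. \<rho>)"
  let ?U = "\<lambda>\<omega>. restrict (sample \<omega>) {..<t}" and ?V = "\<lambda>\<omega>. restrict (sample \<omega>) {t}"
  have ind: "indep_var ?P ?U ?T ?V"
    by (rule indep_var_restrict[OF Z_indep]) auto
  have "expectation (\<lambda>\<omega>. F (?U \<omega>) (?V \<omega> t)) = expectation (\<lambda>\<omega>. \<integral>v. F (?U \<omega>) (v t) \<partial>distr M ?T ?V)"
  proof (rule expectation_indep_var[OF ind, of "\<lambda>u v. F u (v t)" b])
    have [measurable]: "(\<lambda>v. v t) \<in> measurable ?T \<rho>" by (rule measurable_component_singleton) simp
    show "(\<lambda>(u, v). F u (v t)) \<in> borel_measurable (?P \<Otimes>\<^sub>M ?T)" by measurable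
    show "\<bar>F u (v t)\<bar> \<le> b" if "u \<in> space ?P" "v \<in> space ?T" for u v
      using that by (intro bound) (auto simp: space_PiM space_rho PiE_def Pi_def mem_Times_iff)
  qed
  moreover have "(\<integral>v. F (?U \<omega>) (v t) \<partial>distr M ?T ?V) = (\<integral>z. F (?U \<omega>) z \<partial>\<rho>)"
    if \<omega>: "\<omega> \<in> space M" for \<omega>
  proof -
    have U: "?U \<omega> \<in> space ?P" using sample_in[OF \<omega>] by (auto simp: space_PiM space_rho)
    have Fz[measurable]: "F (?U \<omega>) \<in> borel_measurable \<rho>"
      using measurable_compose[OF measurable_Pair1'[OF U] F] by simp
    have [measurable]: "?V \<in> measurable M ?T" by (rule measurable_restrict) simp
    have [measurable]: "(\<lambda>v. v t) \<in> measurable ?T \<rho>" by (rule measurable_component_singleton) simp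
    have "(\<integral>v. F (?U \<omega>) (v t) \<partial>distr M ?T ?V) = (\<integral>n. F (?U \<omega>) (Zs t n) \<partial>M)"
      by (subst integral_distr) auto
    also have "\<dots> = (\<integral>z. F (?U \<omega>) z \<partial>distr M \<rho> (Zs t))"
      by (rule integral_distr[symmetric]) auto
    finally show ?thesis by (simp add: Z_distr)
  qed
  then have "expectation (\<lambda>\<omega>. \<integral>v. F (?U \<omega>) (v t) \<partial>distr M ?T ?V) = expectation (\<lambda>\<omega>. \<integral>z. F (?U \<omega>) z \<partial>\<rho>)"
    by (rule Bochner_Integration.integral_cong[OF refl])
  ultimately show ?thesis by (simp add: past)
qed

lemma expectation_sample:
  fixes f :: "'x \<times> real \<Rightarrow> real"
  assumes "f \<in> borel_measurable \<rho>"
  shows "expectation (\<lambda>\<omega>. f (Zs i \<omega>)) = (\<integral>z. f z \<partial>\<rho>)"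
  using integral_distr[OF Z_meas assms, of i] by (simp add: Z_distr)

text \<open>The vector-valued integral of \<open>a z *\<^sub>R \<Phi> (fst z)\<close> is not available because \<open>'h\<close> need not be second
  countable. Instead, the squared norm of the sum of \<open>n\<close> independent samples has expectation
  \<open>n * D + n * (n - 1) * I\<close>, where \<open>I\<close> is the integral below, and this is nonnegative for every \<open>n\<close>.\<close>

lemma kernel_integral_nonneg:
  assumes a[measurable]: "a \<in> borel_measurable \<rho>" and ab: "\<And>z. z \<in> X \<times> Y \<Longrightarrow> \<bar>a z\<bar> \<le> b"
  shows "0 \<le> (\<integral>z. \<integral>z'. a z * a z' * K (fst z) (fst z') \<partial>\<rho> \<partial>\<rho>)"
proof -
  define g where "g z z' = a z * a z' * K (fst z) (fst z')" for z z'
  define I where "I = (\<integral>z. \<integral>z'. g z z' \<partial>\<rho> \<partial>\<rho>)"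
  define D where "D = (\<integral>z. g z z \<partial>\<rho>)"
  have g_meas: "(\<lambda>n. g (u n) (v n)) \<in> borel_measurable N"
    if "u \<in> measurable N \<rho>" "v \<in> measurable N \<rho>" for u v and N :: "'n measure"
    unfolding g_def using that by (intro borel_measurable_times measurable_K measurable_compose[OF _ a])
  have g_bound: "\<bar>g z z'\<bar> \<le> b * b * \<kappa>\<^sup>2" if "z \<in> X \<times> Y" "z' \<in> X \<times> Y" for z z'
    unfolding g_def abs_mult using that
    by (intro mult_mono ab abs_K_le) (auto intro: order_trans[OF abs_ge_zero ab])
  have g_sym: "g z z' = g z' z" if "z \<in> X \<times> Y" "z' \<in> X \<times> Y" for z z'
    using that unfolding g_def by (auto simp: K_feat inner_commute)
  \<comment> \<open>By symmetry of \<open>g\<close> it suffices to treat the later of the two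
    samples as the fresh one.\<close>
  have lt: "expectation (\<lambda>\<omega>. g (Zs i \<omega>) (Zs j \<omega>)) = I" if "i < j" for i j
  proof -
    have "expectation (\<lambda>\<omega>. g (Zs i \<omega>) (Zs j \<omega>)) = expectation (\<lambda>\<omega>. \<integral>z. g (Zs i \<omega>) z \<partial>\<rho>)"
    proof (rule fresh_sample[of "\<lambda>w. g (w i)" j "b * b * \<kappa>\<^sup>2"])
      show "(\<lambda>(w, z). g (w i) z) \<in> borel_measurable (PiM {..<j} (\<lambda>_. \<rho>) \<Otimes>\<^sub>M \<rho>)"
        unfolding case_prod_beta using that
        by (intro g_meas measurable_compose[OF measurable_fst] measurable_component_singleton measurable_snd) auto
    qed (use that g_bound in auto)
    also have "\<dots> = I"
      unfolding I_def
      by (rule expectation_sample) (auto intro!: rho.borel_measurable_lebesgue_integral g_meas simp: case_prod_unfold)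
    finally show ?thesis .
  qed
  have E: "expectation (\<lambda>\<omega>. g (Zs i \<omega>) (Zs j \<omega>)) = I + (if i = j then D - I else 0)" for i j
  proof (cases i j rule: linorder_cases)
    case less then show ?thesis using lt by simp
  next
    case equal
    then show ?thesis using expectation_sample[OF g_meas[OF measurable_ident measurable_ident], of i]
    unfolding D_def id_def by simp
  next
    case greater
    have "expectation (\<lambda>\<omega>. g (Zs i \<omega>) (Zs j \<omega>)) = expectation (\<lambda>\<omega>. g (Zs j \<omega>) (Zs i \<omega>))"
      by (rule Bochner_Integration.integral_cong[OF refl]) (simp add: g_sym sample_in)
    then show ?thesis using lt[OF greater] greater by simp
  qed
  have int: "integrable M (\<lambda>\<omega>. g (Zs i \<omega>) (Zs j \<omega>))" for i j
    by (rule integrable_const_bound[of _ "b * b * \<kappa>\<^sup>2"]) (auto intro!: g_meas g_bound sample_in)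
  \<comment> \<open>The expectation of a squared norm, divided by \<open>n\<close>. The vectors are
    used only pointwise; what is integrated is the real double sum.\<close>
  have key: "0 \<le> real n * I + (D - I)" if "0 < n" for n
  proof -
    have "0 \<le> expectation (\<lambda>\<omega>. \<Sum>i<n. \<Sum>j<n. g (Zs i \<omega>) (Zs j \<omega>))"
    proof (rule Bochner_Integration.integral_nonneg)
      fix \<omega> assume \<omega>: "\<omega> \<in> space M"
      have "(\<Sum>i<n. \<Sum>j<n. g (Zs i \<omega>) (Zs j \<omega>))
          = (norm (\<Sum>i<n. a (Zs i \<omega>) *\<^sub>R \<Phi> (fst (Zs i \<omega>))))\<^sup>2"
        unfolding power2_norm_eq_inner inner_sum_left inner_sum_right g_def
        using sample_in[OF \<omega>] by (intro sum.cong) (auto simp: K_feat mem_Times_iff inner_commute)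
      then show "0 \<le> (\<Sum>i<n. \<Sum>j<n. g (Zs i \<omega>) (Zs j \<omega>))" by simp
    qed
    also have "\<dots> = (\<Sum>i<n. \<Sum>j<n. I + (if i = j then D - I else 0))"
      using int by (simp add: E)
    also have "\<dots> = real n * (real n * I + (D - I))"
      by (simp add: sum.distrib)
    finally show ?thesis using that by (simp add: zero_le_mult_iff)
  qed
  have "0 \<le> I"
  proof (rule ccontr)
    assume "\<not> 0 \<le> I"
    then obtain n where n: "D - I < real n * (- I)" using reals_Archimedean3[of "- I"] by auto
    have "real (Suc n) * I + (D - I) < 0" using n \<open>\<not> 0 \<le> I\<close> by (simp add: algebra_simps)
    then show False using key[of "Suc n"] by simp
  qed
  then show ?thesis unfolding I_def g_def .
qed

section \<open>One-step descent of the risk\<close>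

lemma rho_self_measurable: "(\<lambda>z. z) \<in> measurable \<rho> \<rho>"
  by (rule measurable_ident_sets) simp

lemma risk_nonneg: "0 \<le> risk f"
  unfolding gen_err_def by (rule Bochner_Integration.integral_nonneg) (auto simp: space_rho intro: loss_nonneg)

lemma loss_integrable:
  assumes "(\<lambda>z. f (fst z)) \<in> borel_measurable \<rho>" "\<And>x. x \<in> X \<Longrightarrow> \<bar>f x\<bar> \<le> b"
  shows "integrable \<rho> (\<lambda>z. \<phi> (snd z) (f (fst z)))"
proof -
  obtain D where "\<And>y s. y \<in> Y \<Longrightarrow> \<bar>s\<bar> \<le> b \<Longrightarrow> \<phi> y s \<le> D" using bounded_on_bounded[OF bdd0] by metis
  then show ?thesis using assms
    by (intro integrable_bounded[of _ D] measurable_phi borel_of_rho[OF rho_self_measurable])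
      (auto simp: loss_nonneg)
qed

text \<open>The bound is uniform over all measurable \<open>f\<close> bounded by \<open>b\<close> on
  \<open>X\<close>, as needed when \<open>f\<close> itself depends on the samples.\<close>

lemma risk_bounded:
  obtains D where "\<And>f. (\<lambda>z. f (fst z)) \<in> borel_measurable \<rho> \<Longrightarrow> (\<And>x. x \<in> X \<Longrightarrow> \<bar>f x\<bar> \<le> b) \<Longrightarrow> \<bar>risk f\<bar> \<le> D"
proof -
  obtain D where D: "\<And>y s. y \<in> Y \<Longrightarrow> \<bar>s\<bar> \<le> b \<Longrightarrow> \<phi> y s \<le> D" using bounded_on_bounded[OF bdd0] by metis
  have "\<bar>risk f\<bar> \<le> D"
    if "(\<lambda>z. f (fst z)) \<in> borel_measurable \<rho>" "\<And>x. x \<in> X \<Longrightarrow> \<bar>f x\<bar> \<le> b" for f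
  proof -
    have "risk f \<le> D" unfolding gen_err_def
      by (rule rho.integral_le_const[OF loss_integrable[OF that]]) (auto simp: space_rho D that)
    then show ?thesis using risk_nonneg[of f] by simp
  qed
  then show thesis using that by blast
qed

text \<open>\<open>L\<close> is the constant of the Hoelder remainder,
  \<open>(\<kappa>\<^sup>2) powr (1 + \<alpha>)\<close> bounds the kernel power in it, and
  \<open>1 + self_const\<close> comes from turning the derivative power into
  \<open>1 + \<phi>\<close>.\<close>

definition descent_const :: real where
  "descent_const = L * (\<kappa>\<^sup>2) powr (1 + \<alpha>) * (1 + self_const)"

lemma descent_const_nonneg: "0 \<le> descent_const"
  unfolding descent_const_def using L_pos self_const_pos by simp

text \<open>The first-order term of the expected decrease is the squared norm of the gradient of the
  risk in the Hilbert space, so it can be dropped.\<close>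

lemma expected_descent:
  assumes f: "(\<lambda>z. f (fst z)) \<in> borel_measurable \<rho>" and fb: "\<And>x. x \<in> X \<Longrightarrow> \<bar>f x\<bar> \<le> b" and e: "0 \<le> e"
  shows "(\<integral>z. risk (\<lambda>x. f x - e * dphi (snd z) (f (fst z)) * K (fst z) x) \<partial>\<rho>)
    \<le> risk f + descent_const * e powr (1 + \<alpha>) * (1 + risk f)"
proof -
  define a where "a z = dphi (snd z) (f (fst z))" for z
  let ?f = "\<lambda>z x. f x - e * a z * K (fst z) x"
  note [measurable] = borel_of_rho[OF rho_self_measurable]
  have a[measurable]: "a \<in> borel_measurable \<rho>"
    unfolding a_def by (intro measurable_dphi f) (auto simp: space_rho)
  obtain D where D: "\<And>y s. y \<in> Y \<Longrightarrow> \<bar>s\<bar> \<le> b \<Longrightarrow> \<bar>dphi y s\<bar> \<le> D"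
    using bounded_on_bounded[OF bdd0] by metis
  have aD: "\<bar>a z\<bar> \<le> D" if "z \<in> X \<times> Y" for z
    unfolding a_def using that by (intro D fb) auto
  have Kp: "(\<lambda>p. K (fst (fst p)) (fst (snd p))) \<in> borel_measurable (\<rho> \<Otimes>\<^sub>M \<rho>)"
    by (intro measurable_K measurable_fst measurable_snd)
  have Kz: "(\<lambda>z'. K (fst z) (fst z')) \<in> borel_measurable \<rho>" if "z \<in> X \<times> Y" for z
    using that by (intro measurable_K rho_self_measurable measurable_const) (simp add: space_rho)
  \<comment> \<open>Formally the inner product of the gradient sampled at \<open>z\<close> with the
    mean gradient, so its own mean is the squared norm of the mean gradient.\<close>
  define q where "q z = (\<integral>z'. a z * a z' * K (fst z) (fst z') \<partial>\<rho>)" for z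
  have q_meas: "q \<in> borel_measurable \<rho>"
    unfolding q_def
    by (rule rho.borel_measurable_lebesgue_integral)
      (auto simp: case_prod_unfold intro!: borel_measurable_times Kp measurable_compose[OF measurable_fst a]
        measurable_compose[OF measurable_snd a])
  have aaK: "\<bar>a z * a z' * K (fst z) (fst z')\<bar> \<le> D * D * \<kappa>\<^sup>2" if "z \<in> X \<times> Y" "z' \<in> X \<times> Y" for z z'
    unfolding abs_mult using that
    by (intro mult_mono aD abs_K_le) (auto intro: order_trans[OF abs_ge_zero aD])
  have int_aaK: "integrable \<rho> (\<lambda>z'. a z * a z' * K (fst z) (fst z'))" if "z \<in> X \<times> Y" for z
    using that aaK[OF that] by (intro integrable_bounded[of _ "D * D * \<kappa>\<^sup>2"] borel_measurable_times a Kz) auto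
  have q_bound: "\<bar>q z\<bar> \<le> D * D * \<kappa>\<^sup>2" if "z \<in> X \<times> Y" for z
  proof -
    have "q z \<le> D * D * \<kappa>\<^sup>2" "- (D * D * \<kappa>\<^sup>2) \<le> q z" unfolding q_def
      using aaK[OF that] int_aaK[OF that]
      by (auto intro!: rho.integral_le_const rho.integral_ge_const simp: space_rho abs_le_iff minus_le_iff)
    then show ?thesis by auto
  qed
  have q_int: "integrable \<rho> q"
    using q_meas q_bound by (intro integrable_bounded[of _ "D * D * \<kappa>\<^sup>2"]) auto
  have f_int: "integrable \<rho> (\<lambda>z. \<phi> (snd z) (f (fst z)))" by (rule loss_integrable[OF f fb])
  have fz_meas: "(\<lambda>z'. ?f z (fst z')) \<in> borel_measurable \<rho>" if "z \<in> X \<times> Y" for z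
    using that by (intro borel_measurable_diff borel_measurable_times f Kz) (auto simp: mem_Times_iff)
  have fz_bound: "\<bar>?f z x\<bar> \<le> b + e * D * \<kappa>\<^sup>2" if "z \<in> X \<times> Y" "x \<in> X" for z x
  proof -
    have "\<bar>e * a z * K (fst z) x\<bar> \<le> e * D * \<kappa>\<^sup>2"
      unfolding abs_mult using that e
      by (intro mult_mono aD abs_K_le) (auto intro: order_trans[OF abs_ge_zero aD] intro!: mult_nonneg_nonneg)
    then show ?thesis using fb[OF that(2)] by linarith
  qed
  define c where "c = L * (\<kappa>\<^sup>2) powr (1 + \<alpha>) * e powr (1 + \<alpha>)"
  have c: "0 \<le> c" using L_pos by (simp add: c_def)
  have point: "risk (?f z) \<le> risk f - e * q z + c * (1 + self_const) * (1 + \<phi> (snd z) (f (fst z)))"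
    if z: "z \<in> X \<times> Y" for z
  proof -
    \<comment> \<open>The remainder depends on the sample \<open>z\<close> alone, through the loss
      at \<open>z\<close>; averaging over \<open>z\<close> turns that loss into
      \<open>risk f\<close>.\<close>
    let ?r = "c * (1 + self_const) * (1 + \<phi> (snd z) (f (fst z)))"
    have "\<phi> (snd z') (?f z (fst z'))
        \<le> \<phi> (snd z') (f (fst z')) - e * (a z * a z' * K (fst z) (fst z')) + ?r" if z': "z' \<in> X \<times> Y" for z'
    proof -
      have y: "snd z' \<in> Y" "snd z \<in> Y" and x: "fst z \<in> X" "fst z' \<in> X" using z z' by auto
      have "L * \<bar>- (e * a z * K (fst z) (fst z'))\<bar> powr (1 + \<alpha>)
          \<le> L * (e * \<bar>a z\<bar> * \<kappa>\<^sup>2) powr (1 + \<alpha>)"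
        using L_pos alpha e abs_K_le[OF x]
        by (intro mult_left_mono powr_mono2) (auto simp: abs_mult intro!: mult_left_mono)
      also have "\<dots> = c * \<bar>a z\<bar> powr (1 + \<alpha>)"
        using e by (simp add: powr_mult c_def)
      also have "\<dots> \<le> ?r"
        using self_bounding_powr[OF y(2), of "f (fst z)"] c unfolding a_def mult.assoc
        by (intro mult_left_mono) auto
      finally show ?thesis
        using loss_smooth[OF y(1), of "f (fst z')" "- (e * a z * K (fst z) (fst z'))"]
        by (simp add: a_def algebra_simps)
    qed
    then have "risk (?f z) \<le> (\<integral>z'. \<phi> (snd z') (f (fst z')) - e * (a z * a z' * K (fst z) (fst z')) + ?r \<partial>\<rho>)"
      unfolding gen_err_def
      by (intro integral_mono loss_integrable[OF fz_meas fz_bound] Bochner_Integration.integrable_add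
          Bochner_Integration.integrable_diff f_int integrable_mult_right int_aaK z) (auto simp: space_rho)
    also have "\<dots> = risk f - e * q z + ?r"
      using f_int int_aaK[OF z]
      by (simp add: gen_err_def q_def rho.prob_space)
    finally show ?thesis .
  qed
  obtain B where B: "\<And>g. (\<lambda>z. g (fst z)) \<in> borel_measurable \<rho> \<Longrightarrow>
      (\<And>x. x \<in> X \<Longrightarrow> \<bar>g x\<bar> \<le> b + e * D * \<kappa>\<^sup>2) \<Longrightarrow> \<bar>risk g\<bar> \<le> B"
    using risk_bounded by blast
  have "(\<lambda>z. risk (?f z)) \<in> borel_measurable \<rho>"
    by (rule risk_measurable)
      (auto intro!: borel_measurable_diff borel_measurable_times Kp measurable_compose[OF measurable_fst a]
        measurable_compose[OF measurable_snd f])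
  then have int_l: "integrable \<rho> (\<lambda>z. risk (?f z))"
    by (rule integrable_bounded[of _ B]) (intro B fz_meas fz_bound, auto)
  have "(\<integral>z. risk (?f z) \<partial>\<rho>) \<le> (\<integral>z. risk f - e * q z + c * (1 + self_const) * (1 + \<phi> (snd z) (f (fst z))) \<partial>\<rho>)"
    using point int_l q_int f_int by (intro integral_mono) (auto simp: space_rho)
  also have "\<dots> = risk f - e * (\<integral>z. q z \<partial>\<rho>) + c * (1 + self_const) * (1 + risk f)"
    using q_int f_int by (simp add: gen_err_def rho.prob_space)
  also have "\<dots> \<le> risk f + c * (1 + self_const) * (1 + risk f)"
    using kernel_integral_nonneg[OF a aD] e unfolding q_def by simp
  finally show ?thesis by (simp add: a_def c_def descent_const_def mult_ac)
qed

section \<open>Mean excess risk\<close>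

definition excess :: "nat \<Rightarrow> (nat \<Rightarrow> 'x \<times> real) \<Rightarrow> real" where
  "excess t w = risk (iter w t) - risk fH"

text \<open>On \<open>X\<close> the iterate is
  \<open>\<lambda>x. inner (hvec w t) (\<Phi> x)\<close>, so it competes with \<open>fH\<close>; the
  risk does not see points outside \<open>X\<close>.\<close>

lemma excess_nonneg:
  assumes "\<forall>i<t. w i \<in> X \<times> Y"
  shows "0 \<le> excess t w"
proof -
  have "risk (iter w t) = risk (\<lambda>x. inner (hvec w t) (\<Phi> x))"
    unfolding gen_err_def using iter_eq_inner[OF assms]
    by (intro Bochner_Integration.integral_cong) (auto simp: space_rho)
  then show ?thesis using fH_min[of "hvec w t"] by (simp add: excess_def)
qed

lemma excess_sample_nonneg: "\<omega> \<in> space M \<Longrightarrow> 0 \<le> excess t (sample \<omega>)"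
  by (intro excess_nonneg) (auto dest: sample_in)

lemma excess_cong: "(\<And>i. i < t \<Longrightarrow> w i = w' i) \<Longrightarrow> excess t w = excess t w'"
  unfolding excess_def using iter_cong[of t w w'] by simp

lemma iter_fst_measurable:
  assumes "\<forall>i<t. w i \<in> X \<times> Y"
  shows "(\<lambda>z. iter w t (fst z)) \<in> borel_measurable \<rho>"
  using assms by (intro iter_measurable rho_self_measurable) (auto simp: space_rho)

lemma integrable_of_bounded:
  fixes f :: "'m \<Rightarrow> real"
  assumes "f \<in> borel_measurable M" "\<And>\<omega>. \<omega> \<in> space M \<Longrightarrow> \<bar>f \<omega>\<bar> \<le> b"
  shows "integrable M f"
  by (rule integrable_const_bound[of _ b]) (use assms in auto)

lemma risk_iter_integrable: "integrable M (\<lambda>\<omega>. risk (iter (sample \<omega>) t))"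
proof -
  obtain b where b: "\<And>w x. (\<forall>i<t. w i \<in> X \<times> Y) \<Longrightarrow> x \<in> X \<Longrightarrow> \<bar>iter w t x\<bar> \<le> b * \<kappa>"
    using iter_bounded by metis
  obtain D where D: "\<And>f. (\<lambda>z. f (fst z)) \<in> borel_measurable \<rho> \<Longrightarrow>
      (\<And>x. x \<in> X \<Longrightarrow> \<bar>f x\<bar> \<le> b * \<kappa>) \<Longrightarrow> \<bar>risk f\<bar> \<le> D"
    using risk_bounded by blast
  show ?thesis
    by (rule integrable_of_bounded[of _ D])
      (auto intro!: risk_iter_measurable D iter_fst_measurable b dest: sample_in)
qed

lemma excess_integrable: "integrable M (\<lambda>\<omega>. excess t (sample \<omega>))"
  unfolding excess_def using risk_iter_integrable by auto

definition mean_excess :: "nat \<Rightarrow> real" where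
  "mean_excess t = expectation (\<lambda>\<omega>. excess t (sample \<omega>))"

lemma mean_excess_nonneg: "0 \<le> mean_excess t"
  unfolding mean_excess_def by (rule Bochner_Integration.integral_nonneg) (rule excess_sample_nonneg)

lemma expectation_risk_iter: "expectation (\<lambda>\<omega>. risk (iter (sample \<omega>) t)) = risk fH + mean_excess t"
  unfolding mean_excess_def excess_def using risk_iter_integrable by (simp add: prob_space)

text \<open>The conditional drift inequality integrated against a past-dependent weight
  \<open>g\<close>, later the indicator that no passage has occurred up to time \<open>t\<close>.
  Positivity of \<open>t\<close> is required because the update rule starts at index 1.\<close>

lemma excess_drift:
  assumes t: "0 < t"
    and g: "g \<in> borel_measurable (PiM {..<t} (\<lambda>_. \<rho>))" "\<And>w. g (restrict w {..<t}) = g w"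
    and g01: "\<And>w. 0 \<le> g w" "\<And>w. g w \<le> (1::real)"
    and gM: "(\<lambda>\<omega>. g (sample \<omega>)) \<in> borel_measurable M"
  shows "expectation (\<lambda>\<omega>. g (sample \<omega>) * excess (Suc t) (sample \<omega>))
    \<le> expectation (\<lambda>\<omega>. g (sample \<omega>) * excess t (sample \<omega>))
      + descent_const * \<eta> t powr (1 + \<alpha>) * (1 + risk fH + mean_excess t)"
proof -
  let ?next = "\<lambda>w z x. iter w t x - \<eta> t * dphi (snd z) (iter w t (fst z)) * K (fst z) x"
  let ?P = "PiM {..<t} (\<lambda>_. \<rho>)"
  define F where "F w z = g w * (risk (?next w z) - risk fH)" for w z
  define c where "c = descent_const * \<eta> t powr (1 + \<alpha>)"
  have c: "0 \<le> c" using descent_const_nonneg by (simp add: c_def)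
  obtain b where b: "\<And>w x. (\<forall>i<Suc t. w i \<in> X \<times> Y) \<Longrightarrow> x \<in> X \<Longrightarrow> \<bar>iter w (Suc t) x\<bar> \<le> b * \<kappa>"
    using iter_bounded by metis
  obtain b' where b': "\<And>w x. (\<forall>i<t. w i \<in> X \<times> Y) \<Longrightarrow> x \<in> X \<Longrightarrow> \<bar>iter w t x\<bar> \<le> b' * \<kappa>"
    using iter_bounded by metis
  obtain D where D: "\<And>f. (\<lambda>z. f (fst z)) \<in> borel_measurable \<rho> \<Longrightarrow>
      (\<And>x. x \<in> X \<Longrightarrow> \<bar>f x\<bar> \<le> b * \<kappa>) \<Longrightarrow> \<bar>risk f\<bar> \<le> D"
    using risk_bounded by blast
  \<comment> \<open>Overwriting coordinate \<open>t\<close> of the path by \<open>z\<close> exhibits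
    the update as an iterate, so the bounds and measurability of iterates apply.\<close>
  have next_eq: "?next w z = iter (w(t := z)) (Suc t)" for w z
  proof -
    have "iter (w(t := z)) t = iter w t" by (rule iter_cong) simp
    then show ?thesis using t by simp
  qed
  have F_bound: "\<bar>F w z\<bar> \<le> D + \<bar>risk fH\<bar>" if w: "\<forall>i<t. w i \<in> X \<times> Y" and z: "z \<in> X \<times> Y" for w z
  proof -
    have "\<forall>i<Suc t. (w(t := z)) i \<in> X \<times> Y" using w z by (auto simp: less_Suc_eq)
    then have "\<bar>risk (?next w z)\<bar> \<le> D"
      unfolding next_eq by (intro D iter_fst_measurable b)
    then have "\<bar>risk (?next w z) - risk fH\<bar> \<le> D + \<bar>risk fH\<bar>" by linarith
    moreover have "\<bar>F w z\<bar> \<le> 1 * \<bar>risk (?next w z) - risk fH\<bar>"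
      unfolding F_def abs_mult using g01 by (intro mult_right_mono) auto
    ultimately show ?thesis by simp
  qed
  have comp: "(\<lambda>p. ((fst p)(t := snd p)) i) \<in> measurable (?P \<Otimes>\<^sub>M \<rho>) \<rho>" if "i < Suc t" for i
    using that by (cases "i = t")
      (auto intro!: measurable_compose[OF measurable_fst] measurable_component_singleton)
  have F_meas: "case_prod F \<in> borel_measurable (?P \<Otimes>\<^sub>M \<rho>)"
    unfolding F_def next_eq case_prod_unfold
    by (intro borel_measurable_times borel_measurable_diff measurable_compose[OF measurable_fst g(1)]
        risk_iter_measurable comp) auto
  have F_past: "F (restrict w {..<t}) z = F w z" for w z
  proof -
    have "iter (restrict w {..<t}) t = iter w t" by (rule iter_cong) simp
    then show ?thesis unfolding F_def by (simp add: g(2))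
  qed
  have F_int: "(\<integral>z. F (sample \<omega>) z \<partial>\<rho>) \<le> g (sample \<omega>) * excess t (sample \<omega>) + c * (1 + risk (iter (sample \<omega>) t))"
    if \<omega>: "\<omega> \<in> space M" for \<omega>
  proof -
    have w: "\<forall>i<t. sample \<omega> i \<in> X \<times> Y" using sample_in[OF \<omega>] by auto
    have "integrable \<rho> (\<lambda>z. risk (?next (sample \<omega>) z))"
    proof (rule integrable_bounded[of _ D])
      show "(\<lambda>z. risk (?next (sample \<omega>) z)) \<in> borel_measurable \<rho>"
        unfolding next_eq using w
        by (intro risk_iter_measurable) (auto simp: less_Suc_eq space_rho intro!: rho_self_measurable)
      show "\<bar>risk (?next (sample \<omega>) (x, y))\<bar> \<le> D" if "x \<in> X" "y \<in> Y" for x y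
        unfolding next_eq using w that by (intro D iter_fst_measurable b) (auto simp: less_Suc_eq)
    qed
    then have "(\<integral>z. F (sample \<omega>) z \<partial>\<rho>) = g (sample \<omega>) * ((\<integral>z. risk (?next (sample \<omega>) z) \<partial>\<rho>) - risk fH)"
      unfolding F_def by (simp add: rho.prob_space)
    also have "\<dots> \<le> g (sample \<omega>) * (risk (iter (sample \<omega>) t) + c * (1 + risk (iter (sample \<omega>) t)) - risk fH)"
      unfolding c_def
      by (intro mult_left_mono diff_right_mono expected_descent[OF iter_fst_measurable[OF w] b'[OF w]]
          eta_nonneg g01)
    also have "\<dots> = g (sample \<omega>) * excess t (sample \<omega>) + g (sample \<omega>) * (c * (1 + risk (iter (sample \<omega>) t)))"
      by (simp add: excess_def algebra_simps)
    \<comment> \<open>The weight stays on the excess but is bounded by 1 on the remainder, whose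
      expectation then involves only \<open>risk fH\<close> and
      \<open>mean_excess t\<close>.\<close>
    also have "\<dots> \<le> g (sample \<omega>) * excess t (sample \<omega>) + 1 * (c * (1 + risk (iter (sample \<omega>) t)))"
      using c risk_nonneg by (intro add_left_mono mult_right_mono g01) (auto intro!: mult_nonneg_nonneg add_nonneg_nonneg)
    finally show ?thesis by simp
  qed
  have int_g: "integrable M (\<lambda>\<omega>. g (sample \<omega>) * excess t (sample \<omega>))"
    by (rule Bochner_Integration.integrable_bound[OF excess_integrable[of t]])
      (auto intro!: borel_measurable_times gM borel_measurable_integrable[OF excess_integrable] mult_left_le_one_le
        simp: abs_mult g01)
  have int_F: "integrable M (\<lambda>\<omega>. \<integral>z. F (sample \<omega>) z \<partial>\<rho>)"
  proof (rule integrable_of_bounded)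
    show "(\<lambda>\<omega>. \<integral>z. F (sample \<omega>) z \<partial>\<rho>) \<in> borel_measurable M"
    proof (rule rho.borel_measurable_lebesgue_integral)
      have "(\<lambda>p. ((sample (fst p))(t := snd p)) i) \<in> measurable (M \<Otimes>\<^sub>M \<rho>) \<rho>" if "i < Suc t" for i
        using that by (cases "i = t") (auto intro!: measurable_compose[OF measurable_fst])
      then show "(\<lambda>(\<omega>, z). F (sample \<omega>) z) \<in> borel_measurable (M \<Otimes>\<^sub>M \<rho>)"
        unfolding F_def next_eq case_prod_unfold
        by (intro borel_measurable_times borel_measurable_diff measurable_compose[OF measurable_fst gM]
            risk_iter_measurable) auto
    qed
    show "\<bar>\<integral>z. F (sample \<omega>) z \<partial>\<rho>\<bar> \<le> D + \<bar>risk fH\<bar>" if \<omega>: "\<omega> \<in> space M" for \<omega>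
    proof -
      have Fb: "\<bar>F (sample \<omega>) z\<bar> \<le> D + \<bar>risk fH\<bar>" if "z \<in> X \<times> Y" for z
        using that sample_in[OF \<omega>] by (intro F_bound) auto
      have "\<bar>\<integral>z. F (sample \<omega>) z \<partial>\<rho>\<bar> \<le> (\<integral>z. \<bar>F (sample \<omega>) z\<bar> \<partial>\<rho>)"
        by (rule integral_abs_bound)
      also have "\<dots> \<le> (\<integral>z. D + \<bar>risk fH\<bar> \<partial>\<rho>)"
        using Fb order_trans[OF abs_ge_zero Fb] rho.not_empty
        by (intro integral_mono') (auto simp: space_rho)
      finally show ?thesis by (simp add: rho.prob_space)
    qed
  qed
  have "expectation (\<lambda>\<omega>. g (sample \<omega>) * excess (Suc t) (sample \<omega>)) = expectation (\<lambda>\<omega>. F (sample \<omega>) (Zs t \<omega>))"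
    unfolding F_def excess_def using t by simp
  also have "\<dots> = expectation (\<lambda>\<omega>. \<integral>z. F (sample \<omega>) z \<partial>\<rho>)"
    by (rule fresh_sample[OF F_meas F_past F_bound])
  also have "\<dots> \<le> expectation (\<lambda>\<omega>. g (sample \<omega>) * excess t (sample \<omega>) + c * (1 + risk (iter (sample \<omega>) t)))"
    by (intro integral_mono int_F F_int Bochner_Integration.integrable_add int_g integrable_mult_right
        risk_iter_integrable) auto
  also have "\<dots> = expectation (\<lambda>\<omega>. g (sample \<omega>) * excess t (sample \<omega>)) + c * (1 + risk fH + mean_excess t)"
    using int_g risk_iter_integrable[of t] by (simp add: expectation_risk_iter prob_space)
  finally show ?thesis by (simp add: c_def)
qed

section \<open>Squared distance to the minimiser\<close>

definition dist_sq :: "nat \<Rightarrow> (nat \<Rightarrow> 'x \<times> real) \<Rightarrow> real" where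
  "dist_sq t w = (norm (hvec w t - hH))\<^sup>2"

text \<open>The reproducing property turns the cross term of the square into a difference of
  function values and the last term into a kernel value, so the increment is built from real
  measurable terms.\<close>

lemma dist_sq_Suc:
  assumes "0 < t" "\<forall>i\<le>t. w i \<in> X \<times> Y"
  shows "dist_sq (Suc t) w = dist_sq t w
    - 2 * \<eta> t * (dphi (snd (w t)) (iter w t (fst (w t))) * (iter w t (fst (w t)) - fH (fst (w t))))
    + (\<eta> t * dphi (snd (w t)) (iter w t (fst (w t))))\<^sup>2 * K (fst (w t)) (fst (w t))"
proof -
  have x: "fst (w t) \<in> X" using assms by (auto simp: mem_Times_iff)
  define s where "s = iter w t (fst (w t))"
  define G where "G = dphi (snd (w t)) s"
  define u where "u = hvec w t - hH"
  have s: "s - fH (fst (w t)) = inner u (\<Phi> (fst (w t)))"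
    using assms x by (simp add: iter_eq_inner fH_feat inner_diff_left s_def u_def)
  have u: "hvec w (Suc t) - hH = u - (\<eta> t * G) *\<^sub>R \<Phi> (fst (w t))"
    using assms by (simp add: u_def G_def s_def)
  show ?thesis
    unfolding dist_sq_def u K_feat[OF x x] s_def[symmetric] G_def[symmetric] u_def[symmetric] s
      power2_norm_eq_inner
    by (simp add: inner_diff_left inner_diff_right inner_commute power2_eq_square algebra_simps)
qed

text \<open>Continuity of \<open>K\<close> makes \<Phi> continuous on \<open>X\<close>, since the
  squared distance of \<open>\<Phi> x'\<close> and \<open>\<Phi> x\<close> is
  \<open>K x' x' - 2 * K x' x + K x x\<close>; hence \<open>fH\<close> is continuous there.\<close>

lemma fH_measurable: "u \<in> measurable N \<rho> \<Longrightarrow> (\<lambda>n. fH (fst (u n))) \<in> borel_measurable N"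
proof -
  have K2: "continuous_on X (\<lambda>x. K (p x) (q x))"
    if "continuous_on X p" "continuous_on X q" "p ` X \<subseteq> X" "q ` X \<subseteq> X" for p q
    using continuous_on_compose2[OF K_cont continuous_on_Pair[OF that(1,2)]] that(3,4) by auto
  have "continuous_on X \<Phi>"
    unfolding continuous_on_def
  proof
    fix x assume x: "x \<in> X"
    have "continuous_on X (\<lambda>x'. sqrt (K x' x' - 2 * K x' x + K x x))"
      using x by (intro continuous_intros K2) auto
    then have "((\<lambda>x'. sqrt (K x' x' - 2 * K x' x + K x x)) \<longlongrightarrow> sqrt (K x x - 2 * K x x + K x x)) (at x within X)"
      using x by (auto simp: continuous_on_def)
    moreover have "eventually (\<lambda>x'. sqrt (K x' x' - 2 * K x' x + K x x) = dist (\<Phi> x') (\<Phi> x)) (at x within X)"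
      unfolding eventually_at_filter
      by (intro always_eventually)
        (auto simp: dist_norm norm_eq_sqrt_inner K_feat x inner_diff_left inner_diff_right inner_commute algebra_simps)
    ultimately have "((\<lambda>x'. dist (\<Phi> x') (\<Phi> x)) \<longlongrightarrow> sqrt (K x x - 2 * K x x + K x x)) (at x within X)"
      by (rule Lim_transform_eventually)
    then show "(\<Phi> \<longlongrightarrow> \<Phi> x) (at x within X)"
      by (subst tendsto_dist_iff) simp
  qed
  then have "continuous_on X (\<lambda>x. inner hH (\<Phi> x))" by (intro continuous_intros)
  then have "continuous_on X fH" using fH_feat by (simp cong: continuous_on_cong)
  moreover assume u: "u \<in> measurable N \<rho>"
  ultimately show ?thesis
    using measurable_compose[OF measurable_restrict_space2[OF _ borel_of_rho(2)[OF u]]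
        borel_measurable_continuous_on_restrict[of X fH]] borel_of_rho(4)[OF u] by auto
qed

lemma dist_sq_integrable: "integrable M (\<lambda>\<omega>. dist_sq t (sample \<omega>))"
proof -
  obtain b where b: "\<And>w. (\<forall>i<t. w i \<in> X \<times> Y) \<Longrightarrow> norm (hvec w t) \<le> b"
    using iter_bounded by metis
  \<comment> \<open>through the real-valued recursion, as \<open>hvec\<close> itself may fail to be measurable\<close>
  have "(\<lambda>\<omega>. dist_sq t (sample \<omega>)) \<in> borel_measurable M"
  proof (induction t)
    case (Suc t)
    show ?case
    proof (cases "t = 0")
      case False
      have s: "(\<lambda>\<omega>. iter (sample \<omega>) t (fst (Zs t \<omega>))) \<in> borel_measurable M"
        by (intro iter_measurable) auto
      have d: "(\<lambda>\<omega>. dphi (snd (Zs t \<omega>)) (iter (sample \<omega>) t (fst (Zs t \<omega>)))) \<in> borel_measurable M"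
        using borel_of_rho[OF Z_meas] by (intro measurable_dphi s) auto
      show ?thesis
        by (subst measurable_cong[OF dist_sq_Suc])
          (use False Suc s d measurable_K[OF Z_meas Z_meas] fH_measurable[OF Z_meas] sample_in in auto)
    qed (simp add: dist_sq_def)
  qed (simp add: dist_sq_def)
  moreover have "\<bar>dist_sq t (sample \<omega>)\<bar> \<le> (b + norm hH)\<^sup>2" if "\<omega> \<in> space M" for \<omega>
  proof -
    have "norm (hvec (sample \<omega>) t - hH) \<le> b + norm hH"
      using b[of "sample \<omega>"] sample_in[OF that] norm_triangle_ineq4[of "hvec (sample \<omega>) t" hH] by force
    then show ?thesis by (simp add: dist_sq_def power_mono)
  qed
  ultimately show ?thesis by (rule integrable_of_bounded)
qed

text \<open>Convexity bounds the cross term by the excess loss over \<open>fH\<close>, self-bounding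
  bounds the quadratic term by a multiple of \<open>1 + \<phi>\<close>, and freshness of the sample
  turns expected losses into expected risks.\<close>

lemma dist_sq_drift:
  assumes t: "0 < t"
  shows "expectation (\<lambda>\<omega>. dist_sq (Suc t) (sample \<omega>)) + 2 * \<eta> t * mean_excess t
    \<le> expectation (\<lambda>\<omega>. dist_sq t (sample \<omega>))
      + (\<eta> t)\<^sup>2 * (self_const * \<kappa>\<^sup>2) * (1 + risk fH + mean_excess t)"
proof -
  let ?l = "\<lambda>\<omega>. \<phi> (snd (Zs t \<omega>)) (iter (sample \<omega>) t (fst (Zs t \<omega>)))"
  let ?lH = "\<lambda>\<omega>. \<phi> (snd (Zs t \<omega>)) (fH (fst (Zs t \<omega>)))"
  let ?C = "self_const * \<kappa>\<^sup>2"
  obtain b where b: "\<And>w x. (\<forall>i<t. w i \<in> X \<times> Y) \<Longrightarrow> x \<in> X \<Longrightarrow> \<bar>iter w t x\<bar> \<le> b * \<kappa>"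
    using iter_bounded by metis
  obtain D where D: "\<And>y s. y \<in> Y \<Longrightarrow> \<bar>s\<bar> \<le> b * \<kappa> \<Longrightarrow> \<phi> y s \<le> D"
    using bounded_on_bounded[OF bdd0] by metis
  have lD: "\<bar>\<phi> (snd z) (iter w t (fst z))\<bar> \<le> D" if "\<forall>i<t. w i \<in> X \<times> Y" "z \<in> X \<times> Y" for w z
  proof -
    have "fst z \<in> X" "snd z \<in> Y" using that(2) by auto
    then show ?thesis using D[OF _ b[OF that(1)]] loss_nonneg by simp
  qed
  have l_int: "integrable M ?l"
    using sample_in borel_of_rho[OF Z_meas]
    by (intro integrable_of_bounded[of _ D] measurable_phi iter_measurable lD) auto
  have l_eq: "expectation ?l = risk fH + mean_excess t"
  proof -
    have "expectation ?l = expectation (\<lambda>\<omega>. \<integral>z. \<phi> (snd z) (iter (sample \<omega>) t (fst z)) \<partial>\<rho>)"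
    proof (rule fresh_sample[of "\<lambda>w z. \<phi> (snd z) (iter w t (fst z))", OF _ _ lD])
      show "(\<lambda>(w, z). \<phi> (snd z) (iter w t (fst z))) \<in> borel_measurable (PiM {..<t} (\<lambda>_. \<rho>) \<Otimes>\<^sub>M \<rho>)"
        unfolding case_prod_unfold
        by (intro measurable_phi iter_measurable borel_of_rho(3)[OF measurable_snd] measurable_snd
            measurable_compose[OF measurable_fst] measurable_component_singleton) auto
      show "\<phi> (snd z) (iter (restrict w {..<t}) t (fst z)) = \<phi> (snd z) (iter w t (fst z))" for w z
        using iter_cong[of t "restrict w {..<t}" w] by simp
    qed
    then show ?thesis using expectation_risk_iter by (simp add: gen_err_def)
  qed
  obtain DH where DH: "\<And>y s. y \<in> Y \<Longrightarrow> \<bar>s\<bar> \<le> norm hH * \<kappa> \<Longrightarrow> \<phi> y s \<le> DH"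
    using bounded_on_bounded[OF bdd0] by metis
  have fH_b: "\<bar>fH x\<bar> \<le> norm hH * \<kappa>" if "x \<in> X" for x
    using Cauchy_Schwarz_ineq2[of hH "\<Phi> x"] norm_feat[OF that] fH_feat[OF that]
      mult_left_mono[of "norm (\<Phi> x)" \<kappa> "norm hH"] by simp
  have lH_int: "integrable M ?lH"
  proof (intro integrable_of_bounded[of _ DH] measurable_phi borel_of_rho[OF Z_meas] fH_measurable Z_meas)
    show "\<bar>?lH \<omega>\<bar> \<le> DH" if "\<omega> \<in> space M" for \<omega>
      using sample_in[OF that, of t] fH_b DH loss_nonneg by (auto simp: mem_Times_iff)
  qed
  have lH_eq: "expectation ?lH = risk fH"
    unfolding gen_err_def
    by (rule expectation_sample)
      (intro measurable_phi borel_of_rho[OF rho_self_measurable] fH_measurable rho_self_measurable)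
  have "expectation (\<lambda>\<omega>. dist_sq (Suc t) (sample \<omega>))
      \<le> expectation (\<lambda>\<omega>. dist_sq t (sample \<omega>) - 2 * \<eta> t * (?l \<omega> - ?lH \<omega>) + (\<eta> t)\<^sup>2 * ?C * (1 + ?l \<omega>))"
  proof (rule integral_mono)
    fix \<omega> assume \<omega>: "\<omega> \<in> space M"
    have x: "fst (Zs t \<omega>) \<in> X" and y: "snd (Zs t \<omega>) \<in> Y" using sample_in[OF \<omega>, of t] by (auto simp: mem_Times_iff)
    define s where "s = iter (sample \<omega>) t (fst (Zs t \<omega>))"
    define G where "G = dphi (snd (Zs t \<omega>)) s"
    have "2 * \<eta> t * (?l \<omega> - ?lH \<omega>) \<le> 2 * \<eta> t * (G * (s - fH (fst (Zs t \<omega>))))"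
      unfolding G_def s_def using eta_nonneg[of t] by (intro mult_left_mono loss_tangent y) auto
    moreover have "(\<eta> t * G)\<^sup>2 * K (fst (Zs t \<omega>)) (fst (Zs t \<omega>)) \<le> (\<eta> t)\<^sup>2 * ?C * (1 + ?l \<omega>)"
    proof -
      have "G\<^sup>2 * K (fst (Zs t \<omega>)) (fst (Zs t \<omega>)) \<le> self_const * (1 + ?l \<omega>) * \<kappa>\<^sup>2"
        unfolding G_def using abs_K_le[OF x x] self_bounding[OF y, of s] self_const_pos loss_nonneg[OF y]
        by (intro mult_mono') (auto simp: s_def K_feat x)
      from mult_left_mono[OF this, of "(\<eta> t)\<^sup>2"] show ?thesis
        by (simp add: power_mult_distrib mult_ac)
    qed
    ultimately show "dist_sq (Suc t) (sample \<omega>)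
        \<le> dist_sq t (sample \<omega>) - 2 * \<eta> t * (?l \<omega> - ?lH \<omega>) + (\<eta> t)\<^sup>2 * ?C * (1 + ?l \<omega>)"
      using dist_sq_Suc[OF t, of "sample \<omega>"] sample_in[OF \<omega>] unfolding G_def s_def by simp
  qed (use dist_sq_integrable l_int lH_int in auto)
  also have "\<dots> = expectation (\<lambda>\<omega>. dist_sq t (sample \<omega>)) - 2 * \<eta> t * (expectation ?l - expectation ?lH)
      + (\<eta> t)\<^sup>2 * ?C * (1 + expectation ?l)"
    using dist_sq_integrable[of t] l_int lH_int by (simp add: prob_space)
  finally show ?thesis by (simp add: l_eq lH_eq add.assoc)
qed

text \<open>The quadratic term of the drift also contains the mean excess. Once
  \<open>\<eta> t * C < 1\<close>, one of the two copies of \<open>\<eta> t * mean_excess t\<close>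
  absorbs it, and the other is summed by telescoping.\<close>

lemma summable_eta_mean_excess:
  assumes eta2: "summable (\<lambda>t. (\<eta> t)\<^sup>2)"
  shows "summable (\<lambda>t. \<eta> t * mean_excess t)"
proof -
  define C where "C = self_const * \<kappa>\<^sup>2"
  have C: "0 \<le> C" using self_const_pos by (simp add: C_def)
  have "(\<lambda>t. (\<eta> t)\<^sup>2) \<longlonglongrightarrow> 0" using eta2 by (rule summable_LIMSEQ_zero)
  then have "(\<lambda>t. sqrt ((\<eta> t)\<^sup>2)) \<longlonglongrightarrow> sqrt 0" by (rule tendsto_real_sqrt)
  then have "\<eta> \<longlonglongrightarrow> 0" using eta_nonneg by simp
  then have "(\<lambda>t. \<eta> t * C) \<longlonglongrightarrow> 0 * C" by (intro tendsto_intros)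
  then have "eventually (\<lambda>t. \<eta> t * C < 1) sequentially" by (intro order_tendstoD) auto
  then obtain T where T: "\<And>t. T \<le> t \<Longrightarrow> \<eta> t * C < 1" by (auto simp: eventually_sequentially)
  show ?thesis
  \<comment> \<open>\<open>Suc T\<close> instead of \<open>T\<close> ensures \<open>0 < t\<close>,
    as \<open>dist_sq_drift\<close> requires.\<close>
  proof (rule summable_of_drift[where T = "Suc T"
        and r = "\<lambda>t. expectation (\<lambda>\<omega>. dist_sq t (sample \<omega>))"
        and b = "\<lambda>t. C * (1 + risk fH) * (\<eta> t)\<^sup>2"])
    fix t assume t: "Suc T \<le> t"
    have "(\<eta> t)\<^sup>2 * C * mean_excess t = (\<eta> t * C) * (\<eta> t * mean_excess t)"
      by (simp add: power2_eq_square)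
    also have "\<dots> \<le> 1 * (\<eta> t * mean_excess t)"
      using T[of t] t eta_nonneg mean_excess_nonneg
      by (intro mult_right_mono) (auto intro!: mult_nonneg_nonneg)
    finally show "expectation (\<lambda>\<omega>. dist_sq (Suc t) (sample \<omega>)) + \<eta> t * mean_excess t
        \<le> expectation (\<lambda>\<omega>. dist_sq t (sample \<omega>)) + C * (1 + risk fH) * (\<eta> t)\<^sup>2"
      using dist_sq_drift[of t] t unfolding C_def[symmetric] by (simp add: algebra_simps)
  qed (use C risk_nonneg eta_nonneg mean_excess_nonneg eta2 in
      \<open>auto simp: dist_sq_def intro!: mult_nonneg_nonneg add_nonneg_nonneg summable_mult\<close>)
qed

section \<open>Almost sure rates\<close>

lemma AE_weighted_excess_bounded:
  assumes eta: "\<And>t. \<eta> t = step \<eta>1 \<theta> t" and \<eta>1: "0 < \<eta>1"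
    and \<theta>: "1 / (1 + \<alpha>) < \<theta>" "\<theta> < 1"
    and \<gamma>: "0 < \<gamma>" "\<gamma> < 1 - \<theta>" "\<gamma> < (1 + \<alpha>) * \<theta> - 1"
  shows "AE \<omega> in M. \<exists>b. \<forall>t. real t powr \<gamma> * excess t (sample \<omega>) \<le> b"
proof -
  have eta': "\<eta> t = \<eta>1 * real t powr (- \<theta>)" for t by (simp add: eta step_def)
  \<comment> \<open>As \<alpha> \<le> 1, the lower bound on \<theta> is at least 1/2, which makes
    the step sizes square summable.\<close>
  have "1 / 2 \<le> 1 / (1 + \<alpha>)" using alpha by (intro divide_left_mono) auto
  with \<theta>(1) have \<theta>2: "1 / 2 < \<theta>" by linarith
  have "(\<eta> t)\<^sup>2 = \<eta>1\<^sup>2 * real t powr (- 2 * \<theta>)" for t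
    by (simp add: eta' power_mult_distrib power2_eq_square powr_add[symmetric])
  moreover have "summable (\<lambda>t. \<eta>1\<^sup>2 * real t powr (- 2 * \<theta>))"
    using \<theta>2 by (intro summable_mult) (simp add: summable_real_powr_iff)
  ultimately have "summable (\<lambda>t. \<eta> t * mean_excess t)"
    by (intro summable_eta_mean_excess) simp
  then have "summable (\<lambda>t. \<eta> t * mean_excess t * (1 / \<eta>1))" by (rule summable_mult2)
  then have sum_e: "summable (\<lambda>t. real t powr (- \<theta>) * mean_excess t)"
    using \<eta>1 by (simp add: eta')
  have sum_e': "summable (\<lambda>t. real t powr p * mean_excess t)" if "p \<le> - \<theta>" for p
  proof (rule summable_comparison_test'[OF sum_e])
    show "norm (real t powr p * mean_excess t) \<le> real t powr (- \<theta>) * mean_excess t" for t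
      using that mean_excess_nonneg[of t]
      by (cases "t = 0") (auto intro!: mult_right_mono powr_mono)
  qed
  define q where "q = \<gamma> - (1 + \<alpha>) * \<theta>"
  \<comment> \<open>The factor 2 pays for
    \<open>real (Suc t) powr \<gamma> \<le> 2 * real t powr \<gamma>\<close>.\<close>
  define c where "c = 2 * descent_const * \<eta>1 powr (1 + \<alpha>)"
  \<comment> \<open>Since \<open>0 powr x = 0\<close>, the weighted excess vanishes at index 0, and
    so do all powers in \<open>d 0\<close>; the extra term pays for the jump to index 1.\<close>
  define d where "d t = (if t = 0 then mean_excess 1 else 0) + real t powr (\<gamma> - 1) * mean_excess t
      + c * ((1 + risk fH) * real t powr q + real t powr q * mean_excess t)" for t
  have c: "0 \<le> c" using descent_const_nonneg by (simp add: c_def)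
  \<comment> \<open>\<open>q < -1\<close> sums the constant part of the remainder,
    \<open>q \<le> - \<theta>\<close> the part carrying the mean excess.\<close>
  have q: "q < -1" "q \<le> - \<theta>" using \<gamma> \<theta> by (auto simp: q_def)
  have "summable d"
    unfolding d_def using q \<gamma> sum_e'
    by (intro summable_add summable_mult) (auto simp: summable_real_powr_iff intro!: summable_finite[of "{0}"])
  moreover have d_nonneg: "0 \<le> d t" for t
    unfolding d_def using c risk_nonneg[of fH] mean_excess_nonneg by (auto intro!: add_nonneg_nonneg mult_nonneg_nonneg)
  moreover have drift: "(\<integral>\<omega>. indicator {\<omega>. \<forall>s\<le>t. real s powr \<gamma> * excess s (sample \<omega>) < l} \<omega> * (real (Suc t) powr \<gamma> * excess (Suc t) (sample \<omega>)) \<partial>M)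
        \<le> (\<integral>\<omega>. indicator {\<omega>. \<forall>s\<le>t. real s powr \<gamma> * excess s (sample \<omega>) < l} \<omega> * (real t powr \<gamma> * excess t (sample \<omega>)) \<partial>M) + d t"
    for t l
  proof -
    \<comment> \<open>For \<open>s \<le> t\<close> the excess reads only coordinates below
      \<open>t\<close>, so this indicator is an admissible weight in
      \<open>excess_drift\<close>.\<close>
    define g :: "(nat \<Rightarrow> 'x \<times> real) \<Rightarrow> real"
      where "g w = of_bool (\<forall>s\<le>t. real s powr \<gamma> * excess s w < l)" for w
    have ind: "indicator {\<omega>. \<forall>s\<le>t. real s powr \<gamma> * excess s (sample \<omega>) < l} \<omega> = g (sample \<omega>)" for \<omega>
      by (simp add: g_def indicator_def)
    have g01: "0 \<le> g w" "g w \<le> 1" for w by (auto simp: g_def)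
    have g_meas: "(\<lambda>n. g (w n)) \<in> borel_measurable N"
      if "\<And>i. i < t \<Longrightarrow> (\<lambda>n. w n i) \<in> measurable N \<rho>" for w and N :: "'n measure"
    proof -
      have [measurable]: "(\<lambda>n. excess s (w n)) \<in> borel_measurable N" if "s \<in> {..t}" for s
        unfolding excess_def using that \<open>\<And>i. i < t \<Longrightarrow> (\<lambda>n. w n i) \<in> measurable N \<rho>\<close>
        by (intro borel_measurable_diff risk_iter_measurable borel_measurable_const) auto
      have "Measurable.pred N (\<lambda>n. \<forall>s\<in>{..t}. real s powr \<gamma> * excess s (w n) < l)"
        by (rule pred_intros_finite) measurable
      then show ?thesis unfolding g_def by simp
    qed
    have gM: "(\<lambda>\<omega>. g (sample \<omega>)) \<in> borel_measurable M" by (rule g_meas) simp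
    have int: "integrable M (\<lambda>\<omega>. g (sample \<omega>) * excess s (sample \<omega>))" for s
      by (rule Bochner_Integration.integrable_bound[OF excess_integrable[of s]])
        (auto intro!: borel_measurable_times gM borel_measurable_integrable[OF excess_integrable]
          mult_left_le_one_le simp: abs_mult g01)
    have le_mean: "expectation (\<lambda>\<omega>. g (sample \<omega>) * excess s (sample \<omega>)) \<le> mean_excess s" for s
      unfolding mean_excess_def using g01 excess_sample_nonneg
      by (intro integral_mono int excess_integrable) (auto intro!: mult_left_le_one_le)
    define I where "I s = expectation (\<lambda>\<omega>. g (sample \<omega>) * excess s (sample \<omega>))" for s
    have W: "expectation (\<lambda>\<omega>. g (sample \<omega>) * (real r powr \<gamma> * excess s (sample \<omega>))) = real r powr \<gamma> * I s" for r s
      by (simp add: I_def mult.left_commute)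
    have "real (Suc t) powr \<gamma> * I (Suc t) \<le> real t powr \<gamma> * I t + d t"
    proof (cases "t = 0")
      case True
      have "I 1 \<le> mean_excess 1" using le_mean by (simp add: I_def)
      moreover have "d 0 = mean_excess 1" by (simp add: d_def)
      ultimately show ?thesis using True by simp
    next
      case False
      then have t: "0 < t" by simp
      define T where "T = real t powr \<gamma>"
      have T': "real (Suc t) powr \<gamma> \<le> T + real t powr (\<gamma> - 1)" "real (Suc t) powr \<gamma> \<le> 2 * T"
      proof -
        have "real (Suc t) powr \<gamma> = T * (1 + 1 / real t) powr \<gamma>"
          using t by (simp add: T_def powr_mult[symmetric] distrib_left add.commute)
        also have "\<dots> \<le> T * (1 + 1 / real t) powr 1"
          using \<gamma> \<theta>2 by (intro mult_left_mono powr_mono) (auto simp: T_def)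
        also have "\<dots> = T + T / real t" by (simp add: distrib_left)
        finally have "real (Suc t) powr \<gamma> \<le> T + T / real t" .
        moreover have "T / real t = real t powr (\<gamma> - 1)" using t by (simp add: T_def powr_diff)
        moreover have "T / real t \<le> T" using t by (simp add: T_def divide_le_eq mult_le_cancel_left1)
        ultimately show "real (Suc t) powr \<gamma> \<le> T + real t powr (\<gamma> - 1)" "real (Suc t) powr \<gamma> \<le> 2 * T" by auto
      qed
      define R where "R = descent_const * \<eta> t powr (1 + \<alpha>) * (1 + risk fH + mean_excess t)"
      have R: "0 \<le> R" unfolding R_def using descent_const_nonneg risk_nonneg[of fH] mean_excess_nonneg[of t] by simp
      have step: "I (Suc t) \<le> I t + R"
        unfolding I_def R_def
      proof (rule excess_drift[OF t _ _ g01 gM])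
        show "g \<in> borel_measurable (PiM {..<t} (\<lambda>_. \<rho>))"
          using g_meas[of "\<lambda>w. w"] by (simp add: measurable_component_singleton)
        have "excess s (restrict w {..<t}) = excess s w" if "s \<le> t" for s w
          using that by (intro excess_cong) auto
        then show "g (restrict w {..<t}) = g w" for w by (simp add: g_def)
      qed
      have I: "0 \<le> I t" "I t \<le> mean_excess t"
        using le_mean g01 excess_sample_nonneg unfolding I_def
        by (auto intro!: Bochner_Integration.integral_nonneg mult_nonneg_nonneg)
      have "real (Suc t) powr \<gamma> * I (Suc t) \<le> real (Suc t) powr \<gamma> * (I t + R)"
        using step by (intro mult_left_mono) auto
      \<comment> \<open>The increment of the weight must be sharp on \<open>I t\<close>; on
        \<open>R\<close> the crude factor 2 is enough, because \<open>T * R\<close> is summable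
        anyway.\<close>
      also have "\<dots> \<le> (T + real t powr (\<gamma> - 1)) * I t + 2 * T * R"
        using T' I R unfolding distrib_left by (intro add_mono mult_right_mono) auto
      also have "\<dots> \<le> T * I t + real t powr (\<gamma> - 1) * mean_excess t + 2 * T * R"
        using I by (simp add: distrib_right mult_left_mono)
      also have "2 * T * R = c * ((1 + risk fH) * real t powr q + real t powr q * mean_excess t)"
      proof -
        have "\<eta> t powr (1 + \<alpha>) = \<eta>1 powr (1 + \<alpha>) * real t powr (- ((1 + \<alpha>) * \<theta>))"
          using \<eta>1 by (simp add: eta' powr_mult powr_powr algebra_simps)
        moreover have "real t powr q = T * real t powr (- ((1 + \<alpha>) * \<theta>))"
          unfolding q_def T_def powr_add[symmetric] by simp
        ultimately show ?thesis by (simp add: R_def c_def algebra_simps)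
      qed
      finally show ?thesis using t by (simp add: d_def T_def)
    qed
    then show ?thesis unfolding ind W .
  qed
  moreover have "integrable M (\<lambda>\<omega>. real t powr \<gamma> * excess t (sample \<omega>))" for t
    using excess_integrable by simp
  moreover have "0 \<le> real t powr \<gamma> * excess t (sample \<omega>)" if "\<omega> \<in> space M" for t \<omega>
    using excess_sample_nonneg[OF that] by simp
  ultimately show ?thesis
    by (intro AE_bounded_of_maximal_inequality[where W = "\<lambda>t \<omega>. real t powr \<gamma> * excess t (sample \<omega>)" and d = d]) auto
qed

lemma AE_excess_rate:
  assumes eta: "\<And>t. \<eta> t = step \<eta>1 \<theta> t" and \<eta>1: "0 < \<eta>1"
    and \<theta>: "1 / (1 + \<alpha>) < \<theta>" "\<theta> < 1" and \<epsilon>: "0 < \<epsilon>"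
  shows "AE \<omega> in M. (\<lambda>t. real t powr (min (1 - \<theta>) ((1 + \<alpha>) * \<theta> - 1) - \<epsilon>) * excess t (sample \<omega>)) \<longlonglongrightarrow> 0"
proof -
  define \<beta> where "\<beta> = min (1 - \<theta>) ((1 + \<alpha>) * \<theta> - 1)"
  have "0 < \<beta>" using \<theta> alpha by (auto simp: \<beta>_def field_simps)
  \<comment> \<open>The maximum with 0 keeps \<gamma> positive even when \<epsilon> exceeds
    \<beta>.\<close>
  then obtain \<gamma> where \<gamma>: "max 0 (\<beta> - \<epsilon>) < \<gamma>" "\<gamma> < \<beta>" using dense[of "max 0 (\<beta> - \<epsilon>)" \<beta>] \<epsilon> by auto
  have "AE \<omega> in M. \<exists>b. \<forall>t. real t powr \<gamma> * excess t (sample \<omega>) \<le> b"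
    using \<gamma> by (intro AE_weighted_excess_bounded[OF eta \<eta>1 \<theta>]) (auto simp: \<beta>_def)
  then show ?thesis
  proof (rule AE_mp, intro AE_I2 impI)
    fix \<omega> assume \<omega>: "\<omega> \<in> space M" and "\<exists>b. \<forall>t. real t powr \<gamma> * excess t (sample \<omega>) \<le> b"
    then obtain b where b: "\<And>t. real t powr \<gamma> * excess t (sample \<omega>) \<le> b" by blast
    show "(\<lambda>t. real t powr (min (1 - \<theta>) ((1 + \<alpha>) * \<theta> - 1) - \<epsilon>) * excess t (sample \<omega>)) \<longlonglongrightarrow> 0"
      unfolding \<beta>_def[symmetric]
    proof (rule tendsto_sandwich[OF _ _ tendsto_const])
      show "eventually (\<lambda>t. 0 \<le> real t powr (\<beta> - \<epsilon>) * excess t (sample \<omega>)) sequentially"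
        using excess_sample_nonneg[OF \<omega>] by simp
      show "eventually (\<lambda>t. real t powr (\<beta> - \<epsilon>) * excess t (sample \<omega>) \<le> real t powr (\<beta> - \<epsilon> - \<gamma>) * b) sequentially"
      proof (rule always_eventually, rule allI)
        fix t
        have "real t powr (\<beta> - \<epsilon>) = real t powr (\<beta> - \<epsilon> - \<gamma>) * real t powr \<gamma>"
          by (simp add: powr_add[symmetric])
        then have "real t powr (\<beta> - \<epsilon>) * excess t (sample \<omega>)
            = real t powr (\<beta> - \<epsilon> - \<gamma>) * (real t powr \<gamma> * excess t (sample \<omega>))"
          by simp
        then show "real t powr (\<beta> - \<epsilon>) * excess t (sample \<omega>) \<le> real t powr (\<beta> - \<epsilon> - \<gamma>) * b"
          using mult_left_mono[OF b powr_ge_zero] by (simp only:)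
      qed
      have "(\<lambda>t. real t powr (\<beta> - \<epsilon> - \<gamma>)) \<longlonglongrightarrow> 0"
        using \<gamma> by (intro tendsto_neg_powr filterlim_real_sequentially) auto
      from tendsto_mult_right[OF this, of b]
      show "(\<lambda>t. real t powr (\<beta> - \<epsilon> - \<gamma>) * b) \<longlonglongrightarrow> 0" by simp
    qed
  qed
qed

end
theorem theorem4:
  fixes X :: "'x::euclidean_space set" and Y :: "real set"
    and K :: "'x \<Rightarrow> 'x \<Rightarrow> real"
    and \<Phi> :: "'x \<Rightarrow> 'h::{real_inner, complete_space}"
    and \<rho> :: "('x \<times> real) measure"
    and \<phi> dphi :: "real \<Rightarrow> real \<Rightarrow> real"
    and \<alpha> L \<kappa> \<eta>1 :: real
    and fH :: "'x \<Rightarrow> real"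
    and M :: "'m measure" and Zs :: "nat \<Rightarrow> 'm \<Rightarrow> 'x \<times> real"
  assumes
    \<comment> \<open>the kernel: continuous on X x X, realised by a feature map into a Hilbert space
        (hence symmetric and positive semi-definite); H_K is the closure of the span of the
        K_x, identified with the functions x \<mapsto> \<langle>h, \<Phi> x\<rangle>\<close>
        K_cont: "continuous_on (X \<times> X) (\<lambda>p. K (fst p) (snd p))"
    and K_feat: "\<And>x x'. x \<in> X \<Longrightarrow> x' \<in> X \<Longrightarrow> K x x' = inner (\<Phi> x) (\<Phi> x')"
    and H_dense: "closure (span (\<Phi> ` X)) = UNIV"
    and K_bdd: "bdd_above ((\<lambda>x. sqrt (K x x)) ` X)"
    and kappa_def: "\<kappa> = (SUP x\<in>X. sqrt (K x x))"
    \<comment> \<open>rho: Borel probability measure on Z = X x Y\<close>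
    and rho_prob: "prob_space \<rho>"
    and rho_sets: "sets \<rho> = sets (restrict_space borel (X \<times> Y))"
    \<comment> \<open>the loss\<close>
    and phi_meas: "(\<lambda>p. \<phi> (fst p) (snd p)) \<in> borel_measurable borel"
    and phi_nonneg: "\<And>y s. y \<in> Y \<Longrightarrow> \<phi> y s \<ge> 0"
    and phi_deriv: "\<And>y s. y \<in> Y \<Longrightarrow> (\<phi> y has_real_derivative dphi y s) (at s)"
    \<comment> \<open>Assumption 1\<close>
    and phi_convex: "\<And>y. y \<in> Y \<Longrightarrow> convex_on UNIV (\<phi> y)"
    and alpha: "0 < \<alpha>" "\<alpha> \<le> 1" and L_pos: "L > 0"
    and holder: "\<And>y s s'. y \<in> Y \<Longrightarrow> \<bar>dphi y s - dphi y s'\<bar> \<le> L * \<bar>s - s'\<bar> powr \<alpha>"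
    \<comment> \<open>existence of a minimizer f_H of E over H_K, and boundedness conditions\<close>
    and fH_in: "\<exists>h::'h. \<forall>x\<in>X. fH x = inner h (\<Phi> x)"
    and fH_min: "\<And>h::'h. gen_err \<rho> \<phi> fH \<le> gen_err \<rho> \<phi> (\<lambda>x. inner h (\<Phi> x))"
    and bdd0: "bdd_above ((\<lambda>y. \<phi> y 0) ` Y)"
    and bddH: "bdd_above ((\<lambda>(x, y). \<phi> y (fH x)) ` (X \<times> Y))"
    \<comment> \<open>i.i.d. samples z_t ~ rho\<close>
    and M_prob: "prob_space M"
    and Z_meas: "\<And>t. Zs t \<in> measurable M \<rho>"
    and Z_distr: "\<And>t. distr M \<rho> (Zs t) = \<rho>"
    and Z_indep: "prob_space.indep_vars M (\<lambda>_. \<rho>) Zs UNIV"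
    \<comment> \<open>initial step size\<close>
    and eta1: "0 < \<eta>1" "\<eta>1 * const_A \<alpha> L * \<kappa>\<^sup>2 \<le> 1"
  shows
    "(\<forall>\<theta>. 1 / (1 + \<alpha>) < \<theta> \<and> \<theta> < 1 \<longrightarrow>
       (\<forall>\<epsilon>>0. AE \<omega> in M.
          ((\<lambda>t. real t powr (min (1 - \<theta>) ((1 + \<alpha>) * \<theta> - 1) - \<epsilon>) *
                 (gen_err \<rho> \<phi> (ogd K dphi (step \<eta>1 \<theta>) (\<lambda>i. Zs i \<omega>) t) - gen_err \<rho> \<phi> fH))
           \<longlonglongrightarrow> 0))) \<and>
     (\<forall>\<epsilon>>0. AE \<omega> in M.
          ((\<lambda>t. real t powr (\<alpha> / (2 + \<alpha>) - \<epsilon>) *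
                 (gen_err \<rho> \<phi> (ogd K dphi (step \<eta>1 (2 / (2 + \<alpha>))) (\<lambda>i. Zs i \<omega>) t)
                  - gen_err \<rho> \<phi> fH))
           \<longlonglongrightarrow> 0))"
proof -
  obtain hH where hH: "\<And>x. x \<in> X \<Longrightarrow> fH x = inner hH (\<Phi> x)" using fH_in by blast
  have setting: "kernel_sgd Y \<phi> dphi \<alpha> L M \<rho> X K \<Phi> \<kappa> fH hH Zs (step \<eta>1 \<theta>)" for \<theta>
  proof (intro kernel_sgd.intro holder_smooth_loss.intro kernel_sgd_axioms.intro)
    show "norm (\<Phi> x) \<le> \<kappa>" if "x \<in> X" for x
      using cSUP_upper[OF that K_bdd] K_feat[OF that that] by (simp add: kappa_def norm_eq_sqrt_inner)
    show "0 \<le> step \<eta>1 \<theta> t" for t using eta1 by (simp add: step_def)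
  qed (use assms hH in auto)
  have rate: "AE \<omega> in M.
      ((\<lambda>t. real t powr (min (1 - \<theta>) ((1 + \<alpha>) * \<theta> - 1) - \<epsilon>) *
        (gen_err \<rho> \<phi> (ogd K dphi (step \<eta>1 \<theta>) (\<lambda>i. Zs i \<omega>) t) - gen_err \<rho> \<phi> fH)) \<longlonglongrightarrow> 0)"
    if "1 / (1 + \<alpha>) < \<theta>" "\<theta> < 1" "0 < \<epsilon>" for \<theta> \<epsilon>
    using kernel_sgd.AE_excess_rate[OF setting refl eta1(1) that]
    by (simp add: kernel_sgd.excess_def[OF setting])
  \<comment> \<open>At this \<theta> the increasing exponent (1 + \<alpha>) \<theta> - 1 meets the
    decreasing 1 - \<theta>, so their minimum is largest.\<close>
  have "1 / (1 + \<alpha>) < 2 / (2 + \<alpha>)" "2 / (2 + \<alpha>) < 1"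
    "min (1 - 2 / (2 + \<alpha>)) ((1 + \<alpha>) * (2 / (2 + \<alpha>)) - 1) = \<alpha> / (2 + \<alpha>)"
    using alpha by (auto simp: field_simps)
  then show ?thesis using rate rate[of "2 / (2 + \<alpha>)"] by simp
qed

end
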